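(* Let $\Omega\subset\hat{\mathbb{C}}$ be a finitely connected domain bounded by $d$ disjoint analytic Jordan curves $\gamma_1,\dots,\gamma_d$, with $\infty\in\Omega$. Let $f$ be a proper holomorphic function of degree $d$ from $\Omega$ to $\mathbb{D}$ and let $\zeta_1,\dots,\zeta_d$ be its zeros (repeated according to multiplicity). Suppose further that, for every $i=1,\dots,d$, there exists a point $p_i$ in the bounded component of $\hat{\mathbb{C}}\setminus\gamma_i$ such that \[ \sum_{i=1}^{d}\omega_{p_i}^{\hat{\mathbb{C}}\setminus\overline{\Omega}}(E)=\sum_{j=1}^{d}\omega_{\zeta_j}^{\Omega}(E) \] for every Borel set $E\subset\partial\Omega$. Then $f$ is a rational function (that is, $f$ is the restriction to $\Omega$ of a rational function).
   Context: $\mathbb{D}=\{z\in\mathbb{C}:|z|<1\}$ and $\hat{\mathbb{C}}$ is the extended complex plane. A map $F:X\to Y$ between topological spaces is proper if $F^{-1}(K)$ is compact for every compact $K\subset Y$. The degree of a proper holomorphic function from $\Omega$ to $\mathbb{D}$ is the number of preimages in $\Omega$, counted with multiplicity, of any point of $\mathbb{D}$. The bounded component of $\hat{\mathbb{C}}\setminus\gamma_i$ is the one not containing $\infty$. For an open set $D\subset\hat{\mathbb{C}}$ whose complement has positive logarithmic capacity and a point $a\in D$, $\omega_a^D$ denotes the harmonic measure of $D$ with respect to $a$; when $D$ is not connected, this is the harmonic measure at $a$ of the connected component $D_a$ of $D$ containing $a$, i.e. $\omega_a^D(E)=\omega_a^{D_a}(E\cap\partial D_a)$ for Borel $E\subset\partial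 D$. *)

theory Defs
  imports "HOL-Complex_Analysis.Complex_Analysis" "HOL-Probability.Probability"
begin

section \<open>The extended complex plane\<close>

datatype rsphere = Fin complex | Infty

instantiation rsphere :: topological_space
begin

definition open_rsphere :: "rsphere set \<Rightarrow> bool" where
  "open U \<longleftrightarrow> open (Fin -` U) \<and> (Infty \<in> U \<longrightarrow> compact (- (Fin -` U)))"

instance
proof
  show "open (UNIV :: rsphere set)"
    by (simp add: open_rsphere_def)
next
  fix S T :: "rsphere set"
  assume "open S" "open T"
  moreover have "- (Fin -` S \<inter> Fin -` T) = - (Fin -` S) \<union> - (Fin -` T)"
    by blast
  ultimately show "open (S \<inter> T)"
    by (auto simp: open_rsphere_def intro: compact_Un)
next
  fix K :: "rsphere set set"
  assume K: "\<forall>S\<in>K. open S"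
  have o: "open (Fin -` \<Union>K)"
    using K by (auto simp: open_rsphere_def vimage_Union)
  have "compact (- (Fin -` \<Union>K))" if inf: "Infty \<in> \<Union>K"
  proof -
    obtain S where S: "S \<in> K" "Infty \<in> S"
      using inf by blast
    then have "compact (- (Fin -` S) \<inter> - (Fin -` \<Union>K))"
      using K o by (intro compact_Int_closed) (auto simp: open_rsphere_def closed_Compl)
    moreover have "- (Fin -` S) \<inter> - (Fin -` \<Union>K) = - (Fin -` \<Union>K)"
      using S by blast
    ultimately show ?thesis by simp
  qed
  then show "open (\<Union>K)"
    using o by (simp add: open_rsphere_def)
qed

end

text \<open>
  This is the one-point compactification of the plane from the library, with
  \<^const>\<open>None\<close> as the added point.
\<close>

fun to_option :: "rsphere \<Rightarrow> complex option" where
  "to_option (Fin z) = Some z"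
| "to_option Infty = None"

lemma to_option_image_iff:
  "None \<in> to_option ` U \<longleftrightarrow> Infty \<in> U"
  "Some z \<in> to_option ` U \<longleftrightarrow> Fin z \<in> U"
proof -
  have eq: "w = Infty" if "None = to_option w" for w
    using that by (cases w) simp_all
  have eq': "w = Fin z" if "Some z = to_option w" for w
    using that by (cases w) simp_all
  show "None \<in> to_option ` U \<longleftrightarrow> Infty \<in> U"
  proof
    assume "Infty \<in> U"
    then show "None \<in> to_option ` U" by (rule rev_image_eqI) simp
  qed (use eq in blast)
  show "Some z \<in> to_option ` U \<longleftrightarrow> Fin z \<in> U"
  proof
    assume "Fin z \<in> U"
    then show "Some z \<in> to_option ` U" by (rule rev_image_eqI) simp
  qed (use eq' in blast)
qed

lemma openin_Alexandroff_euclidean_iff: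
  "openin (Alexandroff_compactification euclidean) V \<longleftrightarrow>
     open (Some -` V) \<and> (None \<in> V \<longrightarrow> compact (- (Some -` V)))" (is "?l \<longleftrightarrow> ?r")
proof
  assume ?l
  then consider A where "open A" "V = Some ` A"
    | C where "compact C" "closed C" "V = insert None (Some ` (- C))"
    unfolding openin_Alexandroff_compactification by (auto simp: Compl_eq_Diff_UNIV)
  then show ?r
  proof cases
    case 1
    then have "Some -` V = A" "None \<notin> V" by auto
    then show ?thesis using 1 by simp
  next
    case 2
    then have "Some -` V = - C" by auto
    then show ?thesis using 2 by (simp add: open_Compl)
  qed
next
  assume r: ?r
  show ?l
  proof (cases "None \<in> V")
    case True
    have "V = insert None (Some ` (UNIV - - (Some -` V)))"
    proof (rule set_eqI)
      fix x show "x \<in> V \<longleftrightarrow> x \<in> insert None (Some ` (UNIV - - (Some -` V)))"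
        using True by (cases x) auto
    qed
    moreover have "compact (- (Some -` V))" "closed (- (Some -` V))"
      using r True by (auto simp: closed_Compl)
    ultimately show ?thesis
      unfolding openin_Alexandroff_compactification
      by (intro disjI2 exI[of _ "- (Some -` V)"]) simp
  next
    case False
    have "V = Some ` (Some -` V)"
    proof (rule set_eqI)
      fix x show "x \<in> V \<longleftrightarrow> x \<in> Some ` (Some -` V)"
        using False by (cases x) auto
    qed
    then show ?thesis
      using r unfolding openin_Alexandroff_compactification by (intro disjI1 exI[of _ "Some -` V"]) simp
  qed
qed

lemma open_rsphere_iff_Alexandroff:
  "open U \<longleftrightarrow> openin (Alexandroff_compactification euclidean) (to_option ` U)"
proof -
  have "Some -` (to_option ` U) = Fin -` U"
    by (simp add: vimage_def to_option_image_iff)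
  then show ?thesis
    by (simp add: openin_Alexandroff_euclidean_iff open_rsphere_def to_option_image_iff)
qed

text \<open>The local coordinate \<open>w = 1/z\<close> at \<open>\<infinity>\<close>; \<^const>\<open>Fin\<close> is the other chart.\<close>

definition chart_inf :: "complex \<Rightarrow> rsphere" where
  "chart_inf w = (if w = 0 then Infty else Fin (inverse w))"


section \<open>Holomorphic functions and rational functions\<close>

definition sphere_holomorphic_on :: "(rsphere \<Rightarrow> complex) \<Rightarrow> rsphere set \<Rightarrow> bool" where
  "sphere_holomorphic_on f U \<longleftrightarrow>
     (f \<circ> Fin) holomorphic_on (Fin -` U) \<and> (f \<circ> chart_inf) holomorphic_on (chart_inf -` U)"

text \<open>The multiplicity with which a nonconstant \<open>f\<close> takes the value \<open>f z\<close> at \<open>z\<close>.\<close>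

definition sphere_mult :: "(rsphere \<Rightarrow> complex) \<Rightarrow> rsphere \<Rightarrow> nat" where
  "sphere_mult f z = nat (case z of
       Fin a \<Rightarrow> zorder (\<lambda>w. f (Fin w) - f (Fin a)) a
     | Infty \<Rightarrow> zorder (\<lambda>w. f (chart_inf w) - f Infty) 0)"

text \<open>
  Properness in the sense that preimages of compact sets are compact; the library's
  \<^const>\<open>proper_map\<close> instead asks for a closed map with compact fibres.
\<close>

definition proper_on ::
    "'a::topological_space set \<Rightarrow> 'b::topological_space set \<Rightarrow> ('a \<Rightarrow> 'b) \<Rightarrow> bool" where
  "proper_on X Y F \<longleftrightarrow>
     F \<in> X \<rightarrow> Y \<and> (\<forall>K. K \<subseteq> Y \<and> compact K \<longrightarrow> compact {x \<in> X. F x \<in> K})"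

definition proper_holomorphic_of_degree ::
    "(rsphere \<Rightarrow> complex) \<Rightarrow> rsphere set \<Rightarrow> nat \<Rightarrow> bool" where
  "proper_holomorphic_of_degree f \<Omega> d \<longleftrightarrow>
     sphere_holomorphic_on f \<Omega> \<and> proper_on \<Omega> (ball 0 1) f \<and>
     (\<forall>w\<in>ball 0 1. finite {z \<in> \<Omega>. f z = w} \<and>
        (\<Sum>z\<in>{z \<in> \<Omega>. f z = w}. sphere_mult f z) = d)"

text \<open>
  The self-map of the sphere given by \<open>p / q\<close>, for coprime \<open>p\<close> and \<open>q \<noteq> 0\<close>.
\<close>

definition rational_map :: "complex poly \<Rightarrow> complex poly \<Rightarrow> rsphere \<Rightarrow> rsphere" where
  "rational_map p q z = (case z of
       Fin a \<Rightarrow> if poly q a = 0 then Infty else Fin (poly p a / poly q a)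
     | Infty \<Rightarrow> if degree q < degree p then Infty
                else Fin (coeff p (degree q) / lead_coeff q))"

definition rational_function :: "(rsphere \<Rightarrow> rsphere) \<Rightarrow> bool" where
  "rational_function R \<longleftrightarrow> (\<exists>p q. q \<noteq> 0 \<and> coprime p q \<and> R = rational_map p q)"


section \<open>Analytic Jordan curves\<close>

definition analytic_Jordan_curve :: "complex set \<Rightarrow> bool" where
  "analytic_Jordan_curve \<gamma> \<longleftrightarrow>
     (\<exists>A h. open A \<and> sphere 0 1 \<subseteq> A \<and> h holomorphic_on A \<and> inj_on h A \<and> \<gamma> = h ` sphere 0 1)"

text \<open>For a Jordan curve missing \<open>\<infinity>\<close>: the component of the complement not containing \<open>\<infinity>\<close>.\<close>

definition bounded_component :: "rsphere set \<Rightarrow> rsphere set" where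
  "bounded_component \<gamma> = {z \<in> - \<gamma>. \<not> connected_component (- \<gamma>) z Infty}"


section \<open>Harmonic measure\<close>

text \<open>
  The mean of \<open>u\<close> over a circle; the integral of an extended real function is the integral of
  its positive part minus that of its negative part. For \<open>u\<close> upper semicontinuous with values
  in \<open>[-\<infinity>, \<infinity>)\<close> the first is finite, so the difference is never \<open>\<infinity> - \<infinity>\<close>.
\<close>

definition circle_mean :: "(complex \<Rightarrow> ereal) \<Rightarrow> complex \<Rightarrow> real \<Rightarrow> ereal" where
  "circle_mean u w r =
     (enn2ereal (\<integral>\<^sup>+t\<in>{0..2 * pi}. e2ennreal (u (w + of_real r * cis t)) \<partial>lborel)
      - enn2ereal (\<integral>\<^sup>+t\<in>{0..2 * pi}. e2ennreal (- u (w + of_real r * cis t)) \<partial>lborel))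
     / ereal (2 * pi)"

text \<open>The function identically \<open>-\<infinity>\<close> counts as subharmonic.\<close>

definition subharmonic_on :: "(complex \<Rightarrow> ereal) \<Rightarrow> complex set \<Rightarrow> bool" where
  "subharmonic_on u U \<longleftrightarrow>
     (\<forall>z\<in>U. u z < \<infinity>) \<and> (\<forall>c. open {z \<in> U. u z < c}) \<and>
     (\<forall>w\<in>U. \<exists>\<rho>>0. ball w \<rho> \<subseteq> U \<and> (\<forall>r. 0 < r \<and> r < \<rho> \<longrightarrow> u w \<le> circle_mean u w r))"

definition sphere_subharmonic_on :: "(rsphere \<Rightarrow> ereal) \<Rightarrow> rsphere set \<Rightarrow> bool" where
  "sphere_subharmonic_on u D \<longleftrightarrow>
     subharmonic_on (u \<circ> Fin) (Fin -` D) \<and> subharmonic_on (u \<circ> chart_inf) (chart_inf -` D)"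

text \<open>The Perron solution of the Dirichlet problem in \<open>D\<close> with boundary data \<open>\<phi>\<close>.\<close>

definition perron :: "rsphere set \<Rightarrow> (rsphere \<Rightarrow> real) \<Rightarrow> rsphere \<Rightarrow> ereal" where
  "perron D \<phi> a =
     (SUP u\<in>{u. sphere_subharmonic_on u D \<and>
               (\<forall>\<zeta>\<in>frontier D. Limsup (at \<zeta> within D) u \<le> ereal (\<phi> \<zeta>))}. u a)"

text \<open>
  \<open>is_harmonic_measure D a \<mu>\<close> says that \<open>\<mu>\<close> is the harmonic measure of \<open>D\<close> with respect to
  \<open>a \<in> D\<close>, i.e. the Borel probability measure on the boundary of the component of \<open>D\<close>
  containing \<open>a\<close> that represents Perron solutions on that component. It is kept as a measure
  on the whole sphere, carried by that boundary. It is meant for open \<open>D\<close> whose complement has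
  positive logarithmic capacity; \<open>\<mu>\<close> then exists and is unique.
\<close>

definition is_harmonic_measure :: "rsphere set \<Rightarrow> rsphere \<Rightarrow> rsphere measure \<Rightarrow> bool" where
  "is_harmonic_measure D a \<mu> \<longleftrightarrow>
     (let D\<^sub>a = connected_component_set D a in
        prob_space \<mu> \<and> sets \<mu> = sets borel \<and> emeasure \<mu> (frontier D\<^sub>a) = 1 \<and>
        (\<forall>\<phi>. continuous_on (frontier D\<^sub>a) \<phi> \<longrightarrow>
           ereal (LINT \<zeta>:frontier D\<^sub>a|\<mu>. \<phi> \<zeta>) = perron D\<^sub>a \<phi> a))"

end

theory Submission
  imports Defs "HOL-Real_Asymp.Real_Asymp" "HOL-Computational_Algebra.Fundamental_Theorem_Algebra"
begin

text \<open>
  Let \<open>u w = \<Sum> i. \<integral> ln \<bar>w - z\<bar> d\<mu> i z\<close> be the logarithmic potential of the common measure. For \<open>w\<close> in \<open>\<Omega>\<close> the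
  kernel is harmonic inside every curve, so \<open>u w = \<Sum> i. ln \<bar>w - p i\<bar>\<close>. For \<open>w\<close> inside the curves,
  differences of the kernel are harmonic on \<open>\<Omega>\<close>, including at infinity, so
  \<open>u w = (\<Sum> j. ln \<bar>w - \<zeta> j\<bar>) + C\<close>, where the zeros at infinity contribute nothing. Both formulas extend to
  the curves along the normals, hence the rational function
  \<open>R = (\<Prod> j. z - \<zeta> j) / (\<Prod> i. z - p i)\<close> has constant modulus on the boundary of \<open>\<Omega>\<close>. Since \<open>f\<close> is proper,
  \<open>f / R\<close> is a zero-free holomorphic function on \<open>\<Omega>\<close> whose modulus tends to a positive constant at the
  boundary, and by the maximum principle it is constant.
\<close>

section \<open>Topology of the sphere\<close>

text \<open>The obstacle is that the kernel is singular on the curves, where the two formulas for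
  the potential must be compared. Two estimates deal with this. Fatou's lemma along a sequence in
  \<Omega>, where each single \<open>\<mu> i\<close> has an explicit potential with a finite limit,
  makes the kernel integrable at a boundary point and excludes an atom there. Along a normal, |z -
  w0| is at most 3 |z - x n| for all z on the boundary of \<Omega>, which dominates the logarithms;
  analyticity of the curves enters here. The approach from inside uses the potential of the same
  \<open>\<mu> i\<close>, so integrability at the boundary is established only once. Since the inner
  formula comes from differences, it has an unknown constant; comparing all points with one base
  point, even across different curves, makes this constant the same on every curve, as the modulus
  of R requires. For the maximum principle, the coordinate 1 / (z - q) with q inside a curve turns
  \<Omega> into a bounded plane domain in which infinity is an ordinary point.\<close>

lemma open_Fin_image [simp]: "open (Fin ` S) \<longleftrightarrow> open S"
proof -
  have "Fin -` Fin ` S = S" by auto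
  then show ?thesis by (auto simp: open_rsphere_def)
qed

lemma open_Fin_vimage: "open U \<Longrightarrow> open (Fin -` U)"
  by (simp add: open_rsphere_def)

lemma bounded_Compl_Fin_vimage:
  assumes "open U" "Infty \<in> U" shows "bounded (- (Fin -` U))"
  using assms by (auto simp: open_rsphere_def compact_imp_bounded)

lemma continuous_on_Fin [continuous_intros]: "continuous_on A Fin"
  by (rule continuous_on_subset[of UNIV])
     (auto simp: continuous_on_open_vimage open_Fin_vimage)

lemma Fin_mem_closure_iff: "Fin z \<in> closure U \<longleftrightarrow> z \<in> closure (Fin -` U)"
proof
  assume z: "Fin z \<in> closure U"
  show "z \<in> closure (Fin -` U)"
    unfolding closure_iff_nhds_not_empty
  proof (intro allI impI)
    fix A S assume *: "S \<subseteq> A" "open S" "z \<in> S"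
    then have "U \<inter> Fin ` S \<noteq> {}"
      using z unfolding closure_iff_nhds_not_empty by (metis image_eqI open_Fin_image subset_refl)
    then show "Fin -` U \<inter> A \<noteq> {}" using * by auto
  qed
next
  assume z: "z \<in> closure (Fin -` U)"
  show "Fin z \<in> closure U"
    unfolding closure_iff_nhds_not_empty
  proof (intro allI impI)
    fix A S assume *: "S \<subseteq> A" "open S" "Fin z \<in> S"
    then have "Fin -` U \<inter> Fin -` S \<noteq> {}"
      using z open_Fin_vimage unfolding closure_iff_nhds_not_empty by (metis subset_refl vimageI)
    then show "U \<inter> A \<noteq> {}" using * by auto
  qed
qed

lemma Infty_notin_closure:
  assumes "bounded (Fin -` U)" "Infty \<notin> U" shows "Infty \<notin> closure U"
proof
  assume z: "Infty \<in> closure U"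
  let ?S = "- Fin ` (closure (Fin -` U))"
  have "Fin -` ?S = - closure (Fin -` U)" by auto
  then have "open ?S" using assms by (auto simp: open_rsphere_def compact_closure)
  moreover have "Infty \<in> ?S" by auto
  ultimately have "U \<inter> ?S \<noteq> {}"
    using z unfolding closure_iff_nhds_not_empty by blast
  then obtain x where x: "x \<in> U" "x \<notin> Fin ` closure (Fin -` U)" by auto
  then obtain y where "x = Fin y" using assms(2) by (cases x) auto
  with x show False using closure_subset[of "Fin -` U"] by auto
qed

lemma Infty_mem_closure:
  assumes "\<not> bounded (Fin -` U)" shows "Infty \<in> closure U"
  unfolding closure_iff_nhds_not_empty
proof (intro allI impI)
  fix A S assume *: "S \<subseteq> A" "open S" "Infty \<in> S"
  then have "bounded (- (Fin -` S))" by (simp add: bounded_Compl_Fin_vimage)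
  then have "\<not> Fin -` U \<subseteq> - (Fin -` S)" using assms bounded_subset by blast
  then show "U \<inter> A \<noteq> {}" using * by auto
qed

lemma frontier_open_iff:
  assumes "open U" shows "Fin z \<in> frontier U \<longleftrightarrow> z \<in> frontier (Fin -` U)"
  using assms by (simp add: frontier_def interior_open open_Fin_vimage Fin_mem_closure_iff)

lemma filtermap_Fin: "filtermap Fin (nhds z) = nhds (Fin z)"
proof (rule filter_eqI)
  fix P
  show "eventually P (filtermap Fin (nhds z)) \<longleftrightarrow> eventually P (nhds (Fin z))"
  proof
    assume "eventually P (filtermap Fin (nhds z))"
    then obtain S where S: "open S" "z \<in> S" "\<forall>x\<in>S. P (Fin x)"
      by (auto simp: eventually_filtermap eventually_nhds)
    then show "eventually P (nhds (Fin z))"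
      unfolding eventually_nhds by (intro exI[of _ "Fin ` S"]) auto
  next
    assume "eventually P (nhds (Fin z))"
    then obtain S where "open S" "Fin z \<in> S" "\<forall>x\<in>S. P x"
      by (auto simp: eventually_nhds)
    then show "eventually P (filtermap Fin (nhds z))"
      unfolding eventually_filtermap eventually_nhds
      by (intro exI[of _ "Fin -` S"]) (auto simp: open_Fin_vimage)
  qed
qed

lemma tendsto_nhds_FinI:
  assumes "isCont (v \<circ> Fin) z" shows "(v \<longlongrightarrow> v (Fin z)) (nhds (Fin z))"
proof -
  have "filterlim (v \<circ> Fin) (nhds (v (Fin z))) (nhds z)"
    using assms by (metis comp_apply isCont_def tendsto_at_iff_tendsto_nhds)
  then show ?thesis
    by (simp add: filterlim_filtermap comp_def flip: filtermap_Fin)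
qed

section \<open>Logarithms of moduli are subharmonic\<close>

lemma has_integral_circle_mean:
  fixes G :: "complex \<Rightarrow> complex"
  assumes "G holomorphic_on ball w \<rho>" "0 < r" "r < \<rho>"
  shows "((\<lambda>t. G (w + of_real r * cis t)) has_integral (2 * pi * G w)) {0..2*pi}"
proof -
  have sub: "cball w r \<subseteq> ball w \<rho>" using assms by auto
  have "((\<lambda>u. G u / (u - w)) has_contour_integral (2 * of_real pi * \<i> * G w)) (circlepath w r)"
    by (rule Cauchy_integral_circlepath)
       (use assms sub in \<open>auto intro: holomorphic_on_subset holomorphic_on_imp_continuous_on\<close>)
  then have "((\<lambda>t. G (w + r * cis t) / (w + r * cis t - w) * r * \<i> * cis t) has_integral
      (2 * of_real pi * \<i> * G w)) {0..2*pi}"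
    by (subst (asm) circlepath_def, subst (asm) has_contour_integral_part_circlepath_iff)
       simp_all
  then have "((\<lambda>t. \<i> * G (w + r * cis t)) has_integral (\<i> * (2 * pi * G w))) {0..2*pi}"
    using assms(2) by (simp add: mult_ac)
  \<comment> \<open>Multiplication by -\<i> removes the factor \<i> that the derivative of the
    circle path has introduced on both sides.\<close>
  from has_integral_mult_right[OF this, of "-\<i>"] show ?thesis
    by (simp flip: mult.assoc)
qed

text \<open>For continuous real data the integrals of the positive and negative parts in
  \<open>circle_mean\<close> are both finite, so their difference is an ordinary integral.\<close>

lemma circle_mean_real:
  fixes g :: "complex \<Rightarrow> real"
  assumes "continuous_on (sphere w r) g" "0 < r"
    and "((\<lambda>t. g (w + of_real r * cis t)) has_integral (2 * pi * m)) {0..2*pi}"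
  shows "circle_mean (\<lambda>z. ereal (g z)) w r = ereal m"
proof -
  define k where "k t = indicator {0..2*pi} t * g (w + of_real r * cis t)" for t
  have "continuous_on {0..2*pi} (\<lambda>t. g (w + of_real r * cis t))"
    by (rule continuous_on_compose2[OF assms(1)])
       (use assms(2) in \<open>auto intro!: continuous_intros simp: dist_norm norm_mult\<close>)
  then have *: "set_integrable lborel {0..2*pi} (\<lambda>t. g (w + of_real r * cis t))"
    by (rule borel_integrable_atLeastAtMost')
  then have "(LINT t:{0..2*pi}|lborel. g (w + of_real r * cis t)) = 2 * pi * m"
    using assms(3) by (simp add: set_borel_integral_eq_integral(2) integral_unique)
  then have k: "integrable lborel k" "integral\<^sup>L lborel k = 2 * pi * m"
    using * unfolding k_def set_integrable_def set_lebesgue_integral_def by simp_all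
  have 1: "(\<integral>\<^sup>+t\<in>{0..2 * pi}. e2ennreal (ereal (g (w + of_real r * cis t))) \<partial>lborel)
      = (\<integral>\<^sup>+t. ennreal (k t) \<partial>lborel)"
    by (intro nn_integral_cong) (auto simp: k_def indicator_def e2ennreal_ereal)
  have 2: "(\<integral>\<^sup>+t\<in>{0..2 * pi}. e2ennreal (- ereal (g (w + of_real r * cis t))) \<partial>lborel)
      = (\<integral>\<^sup>+t. ennreal (- k t) \<partial>lborel)"
    by (intro nn_integral_cong) (auto simp: k_def indicator_def e2ennreal_ereal)
  have f1: "(\<integral>\<^sup>+t. ennreal (k t) \<partial>lborel) < \<infinity>"
    using k(1) by (simp add: real_integrable_def less_top)
  have f2: "(\<integral>\<^sup>+t. ennreal (- k t) \<partial>lborel) < \<infinity>"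
    using k(1) by (simp add: real_integrable_def less_top)
  have e: "enn2ereal x = ereal (enn2real x)" if "x < \<infinity>" for x
    using that by (cases x) auto
  have "circle_mean (\<lambda>z. ereal (g z)) w r
      = ereal (enn2real (\<integral>\<^sup>+t. ennreal (k t) \<partial>lborel) - enn2real (\<integral>\<^sup>+t. ennreal (- k t) \<partial>lborel)) / ereal (2*pi)"
    unfolding circle_mean_def 1 2 e[OF f1] e[OF f2] by simp
  also have "\<dots> = ereal (2 * pi * m) / ereal (2*pi)"
    using real_lebesgue_integral_def[OF k(1)] k(2) by simp
  finally show ?thesis by simp
qed

text \<open>On a disc F = exp g, so c ln |F| = c Re g has the mean value property with equality.
  Because the sign of \<open>c\<close> is free, the lemma covers both ln |F| and its
  negative.\<close>

lemma subharmonic_on_ln_norm: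
  assumes "open U" "F holomorphic_on U" "\<And>z. z \<in> U \<Longrightarrow> F z \<noteq> 0"
    and u: "\<And>z. z \<in> U \<Longrightarrow> u z = ereal (c * ln (cmod (F z)))"
  shows "subharmonic_on u U"
  unfolding subharmonic_on_def
proof (intro conjI ballI allI)
  fix z assume "z \<in> U" then show "u z < \<infinity>" by (simp add: u)
next
  fix b
  have cont: "continuous_on U (\<lambda>z. ereal (c * ln (cmod (F z))))"
    using assms by (auto intro!: continuous_intros holomorphic_on_imp_continuous_on)
  have "open (U \<inter> (\<lambda>z. ereal (c * ln (cmod (F z)))) -` {..<b})"
    using cont assms(1) by (rule continuous_open_preimage) simp
  also have "U \<inter> (\<lambda>z. ereal (c * ln (cmod (F z)))) -` {..<b} = {z\<in>U. u z < b}"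
    by (auto simp: u)
  finally show "open {z\<in>U. u z < b}" .
next
  fix w assume "w \<in> U"
  then obtain \<rho> where \<rho>: "\<rho> > 0" "ball w \<rho> \<subseteq> U" using assms(1) open_contains_ball by blast
  have hF: "F holomorphic_on ball w \<rho>" using assms(2) \<rho>(2) holomorphic_on_subset by blast
  then obtain g where g: "g holomorphic_on ball w \<rho>" "\<And>z. z \<in> ball w \<rho> \<Longrightarrow> F z = exp (g z)"
    using contractible_imp_holomorphic_log[of F "ball w \<rho>"] assms(3) \<rho>(2)
    by (metis convex_imp_contractible convex_ball subset_iff)
  have lnF: "c * ln (cmod (F z)) = c * Re (g z)" if "z \<in> ball w \<rho>" for z
    using that by (simp add: g(2))
  show "\<exists>\<rho>>0. ball w \<rho> \<subseteq> U \<and> (\<forall>r. 0 < r \<and> r < \<rho> \<longrightarrow> u w \<le> circle_mean u w r)"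
  proof (intro exI[of _ \<rho>] conjI allI impI \<rho>)
    fix r assume r: "0 < r \<and> r < \<rho>"
    have in_ball: "w + of_real r * cis t \<in> ball w \<rho>" for t
      using r by (simp add: dist_norm norm_mult)
    have "circle_mean u w r = circle_mean (\<lambda>z. ereal (c * Re (g z))) w r"
      unfolding circle_mean_def using in_ball \<rho>(2) by (simp add: subset_iff u lnF)
    also have "\<dots> = ereal (c * Re (g w))"
    proof (rule circle_mean_real)
      show "continuous_on (sphere w r) (\<lambda>z. c * Re (g z))"
        using g(1) r by (auto intro!: continuous_intros
          intro: continuous_on_subset[OF holomorphic_on_imp_continuous_on])
      have "((\<lambda>t. G (w + of_real r * cis t)) has_integral (2 * pi * G w)) {0..2*pi}" 
        if "G = (\<lambda>z. c * g z)" for G :: "complex \<Rightarrow> complex"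
        using r g(1) that by (intro has_integral_circle_mean[of _ _ \<rho>]) (auto intro!: holomorphic_intros)
      from has_integral_Re[OF this[OF refl]]
      show "((\<lambda>t. c * Re (g (w + of_real r * cis t))) has_integral (2 * pi * (c * Re (g w)))) {0..2*pi}"
        by simp
    qed (use r in auto)
    finally show "u w \<le> circle_mean u w r"
      using \<rho> \<open>w \<in> U\<close> by (simp add: u lnF)
  qed
qed

section \<open>Harmonic measure integrates logarithms\<close>

lemma Limsup_at_within_le:
  fixes v :: "'a::topological_space \<Rightarrow> real"
  assumes "(v \<longlongrightarrow> v x) (nhds x)"
  shows "Limsup (at x within D) (\<lambda>z. ereal (v z)) \<le> ereal (v x)"
proof (cases "at x within D = bot")
  case False
  have "((\<lambda>z. ereal (v z)) \<longlongrightarrow> ereal (v x)) (at x within D)"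
    using assms tendsto_mono[OF inf_le1] unfolding at_within_def by auto
  then show ?thesis using lim_imp_Limsup[OF False] by force
qed (simp add: Limsup_bot bot_ereal_def)

text \<open>Since both \<open>v\<close> and \<open>- v\<close> belong to Perron families, no maximum principle is needed.\<close>

lemma harmonic_measure_integral:
  fixes v :: "rsphere \<Rightarrow> real"
  assumes hm: "is_harmonic_measure D a \<mu>" and Da: "connected_component_set D a = G"
    and sub: "sphere_subharmonic_on (\<lambda>z. ereal (v z)) G"
             "sphere_subharmonic_on (\<lambda>z. ereal (- v z)) G"
    and cont: "\<And>x. x \<in> frontier G \<Longrightarrow> (v \<longlongrightarrow> v x) (nhds x)"
  shows "(LINT x:frontier G|\<mu>. v x) = v a"
proof -
  have "continuous_on (frontier G) v"
    unfolding continuous_on_def at_within_def using cont tendsto_mono[OF inf_le1] by blast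
  then have 1: "ereal (LINT x:frontier G|\<mu>. v x) = perron G v a"
    "ereal (LINT x:frontier G|\<mu>. - v x) = perron G (\<lambda>x. - v x) a"
    using hm Da unfolding is_harmonic_measure_def Let_def by (auto intro: continuous_on_minus)
  have "ereal (v a) \<le> perron G v a"
    unfolding perron_def using sub(1) cont
    by (intro SUP_upper2[of "\<lambda>z. ereal (v z)"]) (auto intro: Limsup_at_within_le)
  moreover have "ereal (- v a) \<le> perron G (\<lambda>x. - v x) a"
    unfolding perron_def using sub(2) cont
    by (intro SUP_upper2[of "\<lambda>z. ereal (- v z)"])
       (auto intro!: Limsup_at_within_le[of "\<lambda>x. - v x"] tendsto_minus simp del: uminus_ereal.simps)
  moreover have "(LINT x:frontier G|\<mu>. - v x) = - (LINT x:frontier G|\<mu>. v x)"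
    by (simp add: set_lebesgue_integral_def)
  ultimately show ?thesis using 1 by (metis ereal_less_eq(3) neg_le_iff_le order_antisym)
qed

section \<open>Analytic Jordan curves and their sides\<close>

lemma analytic_Jordan_curve_path:
  assumes "analytic_Jordan_curve \<gamma>"
  obtains c where "simple_path c" "pathfinish c = pathstart c" "path_image c = \<gamma>"
proof -
  obtain A h where h: "open A" "sphere 0 1 \<subseteq> A" "h holomorphic_on A" "inj_on h A" "\<gamma> = h ` sphere 0 1"
    using assms unfolding analytic_Jordan_curve_def by blast
  show thesis
  proof (rule that[of "h \<circ> circlepath 0 1"])
    show "simple_path (h \<circ> circlepath 0 1)"
      using h by (intro simple_path_continuous_image)
        (auto simp: simple_path_circlepath
          intro: continuous_on_subset[OF holomorphic_on_imp_continuous_on] inj_on_subset)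
  qed (use h in \<open>auto simp: pathfinish_compose pathstart_compose path_image_compose\<close>)
qed

lemma analytic_Jordan_curve_inside:
  assumes "analytic_Jordan_curve \<gamma>"
  shows "compact \<gamma>" "open (inside \<gamma>)" "connected (inside \<gamma>)" "bounded (inside \<gamma>)"
    "frontier (inside \<gamma>) = \<gamma>" "connected (outside \<gamma>)" "\<not> bounded (outside \<gamma>)"
    "inside \<gamma> \<noteq> {}"
proof -
  obtain c where c: "simple_path c" "pathfinish c = pathstart c" "path_image c = \<gamma>"
    using analytic_Jordan_curve_path[OF assms] .
  from Jordan_inside_outside[OF c(1,2)] show "open (inside \<gamma>)" "connected (inside \<gamma>)" "bounded (inside \<gamma>)"
    "frontier (inside \<gamma>) = \<gamma>" "connected (outside \<gamma>)" "\<not> bounded (outside \<gamma>)" "inside \<gamma> \<noteq> {}"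
    unfolding c(3) by blast+
  show "compact \<gamma>" using c by (metis compact_simple_path_image)
qed

text \<open>The inside of the curve and the complement of its closure are open in the sphere, the
  second because the closure is compact. They separate any connected set that misses the
  curve.\<close>

lemma connected_subset_inside:
  assumes "connected S" "compact \<gamma>" "frontier (inside \<gamma>) = \<gamma>" "bounded (inside \<gamma>)" "open (inside \<gamma>)"
    and "S \<inter> Fin ` \<gamma> = {}" "x \<in> S" "x \<in> Fin ` inside \<gamma>"
  shows "S \<subseteq> Fin ` inside \<gamma>"
proof -
  let ?C = "closure (inside \<gamma>)"
  have C: "?C = inside \<gamma> \<union> \<gamma>"
    using assms(3,5) closure_Un_frontier by metis
  have "Fin -` (- Fin ` ?C) = - ?C" by auto
  then have "open (- Fin ` ?C)" using assms(4) by (auto simp: open_rsphere_def compact_closure)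
  moreover have "open (Fin ` inside \<gamma>)" using assms(5) by simp
  moreover have "S \<subseteq> Fin ` inside \<gamma> \<union> - Fin ` ?C" using assms(6) C by auto
  moreover have "Fin ` inside \<gamma> \<inter> - Fin ` ?C \<inter> S = {}" using C by auto
  ultimately have "- Fin ` ?C \<inter> S = {}"
    using connectedD[OF assms(1)] assms(7,8) by blast
  then have "S \<subseteq> Fin ` ?C" by blast
  then show ?thesis using assms(6) C by blast
qed

text \<open>The outside is connected and unbounded, hence accumulates at \<open>Infty\<close> and
  stays connected when \<open>Infty\<close> is added. A point off the curve that is not inside would
  therefore be joined to \<open>Infty\<close>.\<close>

lemma bounded_component_inside:
  assumes \<gamma>: "analytic_Jordan_curve \<gamma>" and p: "p \<in> bounded_component (Fin ` \<gamma>)"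
  shows "p \<in> Fin ` inside \<gamma>"
proof (rule ccontr)
  assume p': "p \<notin> Fin ` inside \<gamma>"
  note J = analytic_Jordan_curve_inside[OF \<gamma>]
  have "p \<in> insert Infty (Fin ` outside \<gamma>)"
  proof (cases p)
    case (Fin x)
    then have "x \<notin> inside \<gamma>" "x \<notin> \<gamma>" using p p' by (auto simp: bounded_component_def)
    then have "x \<in> outside \<gamma>" using inside_Un_outside[of \<gamma>] by blast
    then show ?thesis using Fin by simp
  qed simp
  moreover have "connected (insert Infty (Fin ` outside \<gamma>))"
  proof (rule connected_intermediate_closure[of "Fin ` outside \<gamma>"])
    show "connected (Fin ` outside \<gamma>)"
      using J(6) by (intro connected_continuous_image continuous_on_Fin)
    have "Fin -` Fin ` outside \<gamma> = outside \<gamma>" by auto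
    then show "insert Infty (Fin ` outside \<gamma>) \<subseteq> closure (Fin ` outside \<gamma>)"
      using J(7) Infty_mem_closure[of "Fin ` outside \<gamma>"] closure_subset[of "Fin ` outside \<gamma>"] by auto
  qed auto
  moreover have "insert Infty (Fin ` outside \<gamma>) \<subseteq> - Fin ` \<gamma>"
    using outside_no_overlap[of \<gamma>] by blast
  ultimately have "connected_component (- Fin ` \<gamma>) p Infty"
    unfolding connected_component_def by blast
  then show False using p by (simp add: bounded_component_def)
qed

text \<open>A connected \<Omega> that misses the curve and meets its inside would lie inside, but it
  contains \<open>Infty\<close>.\<close>

lemma domain_disjoint_inside:
  assumes "open \<Omega>" "connected \<Omega>" "Infty \<in> \<Omega>" "analytic_Jordan_curve \<gamma>" "Fin ` \<gamma> \<subseteq> frontier \<Omega>"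
  shows "closure \<Omega> \<inter> Fin ` inside \<gamma> = {}"
proof -
  note J = analytic_Jordan_curve_inside[OF assms(4)]
  have "\<Omega> \<inter> Fin ` \<gamma> = {}" using assms(1,5) by (auto simp: frontier_def interior_open)
  then have "\<Omega> \<inter> Fin ` inside \<gamma> = {}"
    using connected_subset_inside[OF assms(2) J(1,5,4,2)] assms(3) by blast
  moreover have "open (Fin ` inside \<gamma>)" using J(2) by simp
  ultimately show ?thesis by (metis Int_commute open_Int_closure_eq_empty)
qed

text \<open>This identifies the component on which the harmonic measure at \<open>p i\<close> lives.
  The curve belongs to the closure of \<Omega>, so no connected subset of the complement can cross
  it.\<close>

lemma component_inside:
  assumes "open \<Omega>" "connected \<Omega>" "Infty \<in> \<Omega>" "analytic_Jordan_curve \<gamma>" "Fin ` \<gamma> \<subseteq> frontier \<Omega>"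
    and "z \<in> Fin ` inside \<gamma>"
  shows "connected_component_set (- closure \<Omega>) z = Fin ` inside \<gamma>"
proof
  note J = analytic_Jordan_curve_inside[OF assms(4)]
  have sub: "Fin ` inside \<gamma> \<subseteq> - closure \<Omega>" using domain_disjoint_inside[OF assms(1-5)] by auto
  show "Fin ` inside \<gamma> \<subseteq> connected_component_set (- closure \<Omega>) z"
    using assms(6) J(3) sub by (intro connected_component_maximal connected_continuous_image continuous_on_Fin) auto
  show "connected_component_set (- closure \<Omega>) z \<subseteq> Fin ` inside \<gamma>"
  proof (rule connected_subset_inside[OF _ J(1,5,4,2), of _ z])
    have "connected_component_set (- closure \<Omega>) z \<subseteq> - closure \<Omega>"
      by (rule connected_component_subset)
    then show "connected_component_set (- closure \<Omega>) z \<inter> Fin ` \<gamma> = {}"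
      using assms(5) by (auto simp: frontier_def)
    show "z \<in> connected_component_set (- closure \<Omega>) z" using assms(6) sub by auto
  qed (use assms(6) in auto)
qed

lemma frontier_Fin_inside:
  assumes "analytic_Jordan_curve \<gamma>"
  shows "frontier (Fin ` inside \<gamma>) = Fin ` \<gamma>"
proof -
  note J = analytic_Jordan_curve_inside[OF assms]
  have v: "Fin -` Fin ` inside \<gamma> = inside \<gamma>" by auto
  have "Infty \<notin> closure (Fin ` inside \<gamma>)"
    using J(4) v by (intro Infty_notin_closure) auto
  then have "Infty \<notin> frontier (Fin ` inside \<gamma>)" by (auto simp: frontier_def)
  moreover have "Fin z \<in> frontier (Fin ` inside \<gamma>) \<longleftrightarrow> z \<in> \<gamma>" for z
    using J(2,5) by (simp add: frontier_open_iff v)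
  moreover have "Fin z \<in> Fin ` \<gamma> \<longleftrightarrow> z \<in> \<gamma>" for z by auto
  ultimately show ?thesis
  proof (intro set_eqI)
    fix x assume "Infty \<notin> frontier (Fin ` inside \<gamma>)"
      "\<And>z. Fin z \<in> frontier (Fin ` inside \<gamma>) \<longleftrightarrow> z \<in> \<gamma>" "\<And>z. Fin z \<in> Fin ` \<gamma> \<longleftrightarrow> z \<in> \<gamma>"
    then show "x \<in> frontier (Fin ` inside \<gamma>) \<longleftrightarrow> x \<in> Fin ` \<gamma>" by (cases x) auto
  qed
qed

section \<open>Approaching an analytic curve along its normals\<close>

lemma holomorphic_locally_bilipschitz:
  assumes "k holomorphic_on S" "open S" "z \<in> S" "deriv k z \<noteq> 0"
  obtains \<rho> c where "\<rho> > 0" "c > 0" "ball z \<rho> \<subseteq> S"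
    "\<And>s t. s \<in> ball z \<rho> \<Longrightarrow> t \<in> ball z \<rho> \<Longrightarrow> c * cmod (s - t) \<le> cmod (k s - k t)"
    "\<And>s t. s \<in> ball z \<rho> \<Longrightarrow> t \<in> ball z \<rho> \<Longrightarrow> cmod (k s - k t) \<le> 3 * c * cmod (s - t)"
proof -
  define c where "c = cmod (deriv k z) / 2"
  have c: "c > 0" using assms(4) by (simp add: c_def)
  have "continuous_on S (deriv k)"
    using assms by (intro holomorphic_on_imp_continuous_on holomorphic_deriv)
  then have "isCont (deriv k) z" using assms(2,3) by (simp add: continuous_on_eq_continuous_at)
  then obtain r where r: "r > 0" "\<And>s. dist s z < r \<Longrightarrow> dist (deriv k s) (deriv k z) < c"
    using c unfolding continuous_at_eps_delta by blast
  obtain r' where r': "r' > 0" "ball z r' \<subseteq> S" using assms(2,3) open_contains_ball by blast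
  define \<rho> where "\<rho> = min r r'"
  define g where "g s = k s - deriv k z * s" for s
  have g: "cmod (g s - g t) \<le> c * cmod (s - t)" if "s \<in> ball z \<rho>" "t \<in> ball z \<rho>" for s t
  proof (rule field_differentiable_bound[where S = "ball z \<rho>" and f' = "\<lambda>s. deriv k s - deriv k z"])
    fix s assume s: "s \<in> ball z \<rho>"
    then have "s \<in> S" using r' by (auto simp: \<rho>_def)
    then have "(k has_field_derivative deriv k s) (at s)"
      using assms(1,2) by (rule holomorphic_derivI[rotated 2])
    then have "(k has_field_derivative deriv k s) (at s within ball z \<rho>)"
      by (rule has_field_derivative_at_within)
    then show "(g has_field_derivative deriv k s - deriv k z) (at s within ball z \<rho>)"
      unfolding g_def by (auto intro!: derivative_eq_intros)
    show "cmod (deriv k s - deriv k z) \<le> c"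
      using r(2)[of s] s by (auto simp: \<rho>_def dist_norm norm_minus_commute)
  qed (use that in auto)
  have e: "k s - k t = (g s - g t) + deriv k z * (s - t)" for s t by (simp add: g_def algebra_simps)
  have m: "cmod (deriv k z * (s - t)) = 2 * c * cmod (s - t)" for s t
    by (simp add: c_def norm_mult)
  show thesis
  proof (rule that)
    show "\<rho> > 0" "c > 0" "ball z \<rho> \<subseteq> S" using r r' c by (auto simp: \<rho>_def)
    fix s t assume st: "s \<in> ball z \<rho>" "t \<in> ball z \<rho>"
    show "c * cmod (s - t) \<le> cmod (k s - k t)"
      using g[OF st] m[of s t]
        norm_triangle_ineq4[of "k s - k t" "g s - g t"] by (simp add: e)
    show "cmod (k s - k t) \<le> 3 * c * cmod (s - t)"
      using g[OF st] m[of s t] norm_triangle_ineq[of "g s - g t" "deriv k z * (s - t)"] by (simp add: e)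
  qed
qed

text \<open>
  The normal direction is \<open>k (\<i> t)\<close> in the parametrization \<open>k s = h (e * exp (\<i> s))\<close>, in which
  the two sides of the curve are the convex half discs.
\<close>

lemma analytic_curve_normal_approach:
  assumes \<gamma>: "analytic_Jordan_curve \<gamma>" "w0 \<in> \<gamma>" and B: "closed (B - \<gamma>)" "\<gamma> \<subseteq> B"
    and U: "U \<inter> B = {}" "frontier U \<subseteq> B" "w0 \<in> closure U"
  obtains x :: "nat \<Rightarrow> complex" where "\<And>n. x n \<in> U" "x \<longlonglongrightarrow> w0"
    "\<And>n z. z \<in> B \<Longrightarrow> cmod (z - w0) \<le> 3 * cmod (z - x n)"
proof -
  obtain A h where h: "open A" "sphere 0 1 \<subseteq> A" "h holomorphic_on A" "inj_on h A" "\<gamma> = h ` sphere 0 1"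
    using \<gamma>(1) unfolding analytic_Jordan_curve_def by blast
  then obtain e where e: "cmod e = 1" "w0 = h e" using \<gamma>(2) by auto
  have eA: "e \<in> A" using e h(2) by auto
  define E where "E s = e * exp (\<i> * s)" for s
  define k where "k s = h (E s)" for s
  define S0 where "S0 = E -` A"
  have Ehol: "E holomorphic_on X" for X unfolding E_def by (intro holomorphic_intros)
  have S0: "open S0" "0 \<in> S0"
    unfolding S0_def using h(1) eA Ehol[of UNIV] 
    by (auto simp: E_def[of 0] intro!: open_vimage holomorphic_on_imp_continuous_on)
  have khol0: "k holomorphic_on S0"
    unfolding k_def by (rule holomorphic_on_compose_gen[OF Ehol h(3), unfolded comp_def]) (auto simp: S0_def)
  have k0: "k 0 = w0" by (simp add: k_def E_def e)
  \<comment> \<open>Removing the preimage of the other curves ensures that on \<open>S\<close> the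
    map \<open>k\<close> meets \<open>B\<close> only in \<open>\<gamma>\<close>, and then, as
    \<open>h\<close> is injective, only at real parameters.\<close>
  define S where "S = S0 \<inter> k -` (- (B - \<gamma>))"
  have S: "open S" "0 \<in> S" "k holomorphic_on S"
  proof -
    show "open S" unfolding S_def
      by (intro continuous_open_preimage holomorphic_on_imp_continuous_on khol0 S0 open_Compl B)
    show "0 \<in> S" using S0 k0 \<gamma>(2) by (simp add: S_def)
    show "k holomorphic_on S" using khol0 by (rule holomorphic_on_subset) (simp add: S_def)
  qed
  have kB: "Im s = 0" if "s \<in> S" "k s \<in> B" for s
  proof -
    have "k s \<in> \<gamma>" using that by (auto simp: S_def)
    then obtain e' where "cmod e' = 1" "h (E s) = h e'" using h(5) by (auto simp: k_def)
    then have "E s = e'" using h(2,4) that(1) by (auto simp: S_def S0_def dest: inj_onD)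
    then have "cmod (exp (\<i> * s)) = 1" using \<open>cmod e' = 1\<close> e(1) by (auto simp: E_def norm_mult)
    then show ?thesis by simp
  qed
  have "deriv h e \<noteq> 0" using h(1,3,4) eA by (metis holomorphic_injective_imp_regular)
  moreover have "(k has_field_derivative (deriv h e * (\<i> * e))) (at 0)"
    unfolding k_def
  proof (rule DERIV_chain'[where f = E])
    show "(E has_field_derivative \<i> * e) (at 0)"
      unfolding E_def by (auto intro!: derivative_eq_intros)
    show "(h has_field_derivative deriv h e) (at (E 0))"
      using h eA by (auto simp: E_def intro: holomorphic_derivI)
  qed
  moreover have "e \<noteq> 0" using e(1) by auto
  ultimately have "deriv k 0 \<noteq> 0" by (simp add: DERIV_imp_deriv)
  then obtain \<rho> c where
    \<rho>: "\<rho> > 0" "c > 0" "ball 0 \<rho> \<subseteq> S"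
    and lo: "\<And>s t. s \<in> ball 0 \<rho> \<Longrightarrow> t \<in> ball 0 \<rho> \<Longrightarrow> c * cmod (s - t) \<le> cmod (k s - k t)"
    and up: "\<And>s t. s \<in> ball 0 \<rho> \<Longrightarrow> t \<in> ball 0 \<rho> \<Longrightarrow> cmod (k s - k t) \<le> 3 * c * cmod (s - t)"
    using holomorphic_locally_bilipschitz[OF S(3,1,2)] by (metis (no_types, lifting))
  have kb: "k holomorphic_on ball 0 \<rho>" using S(3) \<rho>(3) holomorphic_on_subset by blast
  moreover have "inj_on k (ball 0 \<rho>)"
    using lo \<rho>(2) by (intro inj_onI) (metis eq_iff_diff_eq_0 mult_le_0_iff norm_le_zero_iff norm_zero not_le)
  ultimately have oV: "open (k ` ball 0 \<rho>)" using open_mapping_thm3 by blast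
  moreover have w0V: "w0 \<in> k ` ball 0 \<rho>" using k0 \<rho>(1) by (metis centre_in_ball imageI)
  ultimately obtain \<eta> where \<eta>: "\<eta> > 0" "ball w0 \<eta> \<subseteq> k ` ball 0 \<rho>"
    using open_contains_ball by blast
  have "k ` ball 0 \<rho> \<inter> U \<noteq> {}"
    using oV w0V U(3) open_Int_closure_eq_empty[OF oV, of U] by blast
  then obtain s0 where s0: "s0 \<in> ball 0 \<rho>" "k s0 \<in> U" by blast
  have "Im s0 \<noteq> 0"
  proof
    assume "Im s0 = 0"
    then have "E s0 \<in> sphere 0 1" using e(1) by (simp add: E_def norm_mult)
    then have "k s0 \<in> \<gamma>" by (simp add: k_def h(5))
    then show False using s0(2) U(1) B(2) by blast
  qed
  then have \<sigma>: "\<bar>sgn (Im s0)\<bar> = 1" "sgn (Im s0) * Im s0 > 0" by (auto simp: sgn_if)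
  \<comment> \<open>The sign selects the half disc containing a parameter of a point of
    \<open>U\<close>. The image of this half disc is connected and misses \<open>B\<close>, hence
    the frontier of \<open>U\<close>, so all of it lies in \<open>U\<close>.\<close>
  define \<sigma> where "\<sigma> = sgn (Im s0)"
  define T where "T = ball 0 \<rho> \<inter> {s. \<sigma> * Im s > 0}"
  have "k ` T \<subseteq> U"
  proof (rule ccontr)
    assume "\<not> k ` T \<subseteq> U"
    moreover have "connected (k ` T)"
    proof (intro connected_continuous_image convex_connected)
      show "continuous_on T k"
        using kb by (intro holomorphic_on_imp_continuous_on) (auto simp: T_def intro: holomorphic_on_subset)
      have "{s. \<sigma> * Im s > 0} = {s. (\<sigma> *\<^sub>R \<i>) \<bullet> s > 0}"
        by (auto simp: inner_complex_def)
      then have "convex {s. \<sigma> * Im s > 0}" by (simp only: convex_halfspace_gt)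
      then show "convex T" unfolding T_def by (intro convex_Int convex_ball)
    qed
    moreover have "k s0 \<in> k ` T" using s0 \<sigma> by (auto simp: T_def \<sigma>_def)
    ultimately have "k ` T \<inter> frontier U \<noteq> {}"
      using s0(2) by (intro connected_Int_frontier) auto
    then obtain s where "s \<in> T" "k s \<in> B" using U(2) by auto
    then show False using kB[of s] \<rho>(3) by (auto simp: T_def)
  qed
  \<comment> \<open>As \<open>k\<close> stretches by at most 3 c, the bound \<eta> / (6 c) keeps
    \<open>x n\<close> within \<eta> / 2 of \<open>w0\<close>. The shift by 2 in
    \<open>\<tau>n\<close> makes every term strictly smaller than \<tau>, including the
    first.\<close>
  define \<tau> where "\<tau> = min \<rho> (\<eta> / (6 * c))"
  define \<tau>n where "\<tau>n n = \<tau> / (real n + 2)" for n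
  define x where "x n = k (\<i> * of_real (\<sigma> * \<tau>n n))" for n
  have \<tau>: "\<tau> > 0" using \<rho> \<eta> by (simp add: \<tau>_def)
  have \<tau>n: "0 < \<tau>n n" "\<tau>n n < \<tau>" for n
    using \<tau> by (simp_all add: \<tau>n_def field_simps add_pos_nonneg)
  have \<sigma>1: "\<bar>\<sigma>\<bar> = 1" "\<sigma> * \<sigma> = 1"
    using \<open>Im s0 \<noteq> 0\<close> by (auto simp: \<sigma>_def sgn_if)
  have inb: "\<i> * of_real (\<sigma> * \<tau>n n) \<in> ball 0 \<rho>" for n
  proof -
    have "cmod (\<i> * of_real (\<sigma> * \<tau>n n)) = \<tau>n n"
      using \<sigma>1(1) \<tau>n(1)[of n] by (simp add: norm_mult)
    then show ?thesis using \<tau>n(2)[of n] unfolding \<tau>_def by simp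
  qed
  show ?thesis
  proof (rule that[of x])
    fix n
    have "\<sigma> * (\<sigma> * \<tau>n n) > 0"
      using \<tau>n[of n] \<sigma>1(2) by (metis mult.assoc mult_1)
    then have "\<i> * of_real (\<sigma> * \<tau>n n) \<in> T"
      using inb[of n] by (simp add: T_def)
    then show "x n \<in> U" using \<open>k ` T \<subseteq> U\<close> by (auto simp: x_def)
  next
    have "\<tau>n \<longlonglongrightarrow> 0" unfolding \<tau>n_def by real_asymp
    then have "(\<lambda>n. \<i> * of_real (\<sigma> * \<tau>n n)) \<longlonglongrightarrow> \<i> * of_real (\<sigma> * 0)"
      by (intro tendsto_intros)
    then have lim: "(\<lambda>n. \<i> * of_real (\<sigma> * \<tau>n n)) \<longlonglongrightarrow> 0" by simp
    have "isCont k 0"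
      using kb \<rho>(1) by (meson centre_in_ball continuous_on_eq_continuous_at holomorphic_on_imp_continuous_on open_ball)
    from isCont_tendsto_compose[OF this lim] show "x \<longlonglongrightarrow> w0"
      unfolding x_def k0 .
  next
    fix n z assume z: "z \<in> B"
    show "cmod (z - w0) \<le> 3 * cmod (z - x n)"
    proof (cases "z \<in> k ` ball 0 \<rho>")
      case True
      then obtain s where s: "s \<in> ball 0 \<rho>" "z = k s" by blast
      then have "Im s = 0" using kB[of s] z \<rho>(3) by blast
      \<comment> \<open>A real \<open>s\<close> is at least as far from a point on the imaginary
        axis as from 0. In the parameter plane no constant is lost; the factor 3 comes from
        \<open>lo\<close> and \<open>up\<close> alone.\<close>
      then have "cmod s \<le> cmod (s - \<i> * of_real (\<sigma> * \<tau>n n))"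
        using abs_Re_le_cmod[of "s - \<i> * of_real (\<sigma> * \<tau>n n)"] by (simp add: cmod_eq_Re)
      then have "c * cmod s \<le> c * cmod (s - \<i> * of_real (\<sigma> * \<tau>n n))"
        using \<rho>(2) by (intro mult_left_mono) auto
      also have "\<dots> \<le> cmod (z - x n)" using lo[OF s(1) inb[of n]] unfolding s(2) x_def .
      finally have 1: "c * cmod s \<le> cmod (z - x n)" .
      have "cmod (z - w0) \<le> 3 * c * cmod s"
        using up[OF s(1), of 0] \<rho>(1) unfolding s(2) k0 by simp
      then show ?thesis using 1 by linarith
    next
      case False
      then have "z \<notin> ball w0 \<eta>" using \<eta>(2) by blast
      then have 1: "\<eta> \<le> cmod (z - w0)" by (simp add: dist_norm norm_minus_commute)
      have "cmod (\<i> * of_real (\<sigma> * \<tau>n n)) = \<tau>n n"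
        using \<sigma>1(1) \<tau>n(1)[of n] by (simp add: norm_mult)
      then have 2: "cmod (x n - w0) \<le> 3 * c * \<tau>n n"
        using up[OF inb[of n], of 0] \<rho>(1) unfolding x_def k0 by simp
      have 3: "3 * c * \<tau>n n \<le> 3 * c * (\<eta> / (6 * c))"
        using \<tau>n(2)[of n] \<rho>(2) by (intro mult_left_mono) (auto simp: \<tau>_def)
      have 4: "3 * c * (\<eta> / (6 * c)) = \<eta> / 2" using \<rho>(2) by simp
      have "cmod (x n - w0) \<le> \<eta> / 2" using 2 3 unfolding 4 by (rule order_trans)
      moreover have "cmod (z - w0) \<le> cmod (z - x n) + cmod (x n - w0)"
        using norm_triangle_ineq[of "z - x n" "x n - w0"] by simp
      \<comment> \<open>Away from the coordinate patch |x n - w0| is at most half of |z - w0|, which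
        gives the estimate even with 2 in place of 3.\<close>
      ultimately show ?thesis
        using norm_ge_zero[of "z - x n"] 1 by linarith
    qed
  qed
qed

section \<open>Transport of measures to the plane\<close>

text \<open>A total left inverse of \<open>Fin\<close>, since pushing a measure forward needs a map
  on the whole sphere. It is applied to measures carried by finite points.\<close>

fun fin_part :: "rsphere \<Rightarrow> complex" where
  "fin_part (Fin z) = z"
| "fin_part Infty = 0"

lemma Fin_image_borel: "E \<in> sets borel \<Longrightarrow> Fin ` E \<in> sets borel"
proof -
  assume E: "E \<in> sets borel"
  have "Fin ` (UNIV :: complex set) \<in> sets borel" by (rule borel_open) simp
  have "E \<in> sigma_sets UNIV {S. open S}" using E by (simp add: borel_def)
  then show ?thesis
  proof induction
    case (Basic a) then show ?case by (intro borel_open) simp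
  next
    case (Compl a)
    have "Fin ` (UNIV - a) = Fin ` UNIV - Fin ` a" by auto
    then show ?case using Compl \<open>Fin ` UNIV \<in> sets borel\<close> by auto
  next
    case (Union a) then show ?case by (auto simp: image_UN)
  qed auto
qed

lemma measurable_fin_part [measurable]: "fin_part \<in> borel_measurable borel"
proof (rule borel_measurableI)
  fix S :: "complex set" assume S: "open S"
  have "fin_part -` S = Fin ` S \<union> (if 0 \<in> S then - Fin ` UNIV else {})"
  proof (rule set_eqI)
    fix x show "x \<in> fin_part -` S \<longleftrightarrow> x \<in> Fin ` S \<union> (if 0 \<in> S then - Fin ` UNIV else {})"
      by (cases x) auto
  qed
  moreover have "Fin ` S \<in> sets borel" "Fin ` (UNIV :: complex set) \<in> sets borel"
    using S by (auto intro!: borel_open)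
  ultimately show "fin_part -` S \<inter> space borel \<in> sets borel" by auto
qed

text \<open>Almost everywhere \<open>fin_part\<close> inverts \<open>Fin\<close>, so nothing is lost
  in passing to the plane. The carrier \<Gamma> is left general: it is a single curve when the
  integral against \<open>\<mu> i\<close> is evaluated, and the whole boundary when the two families
  are compared.\<close>

lemma fin_part_distr:
  assumes \<mu>: "prob_space \<mu>" "sets \<mu> = sets borel" "emeasure \<mu> (Fin ` \<Gamma>) = 1" and \<Gamma>: "\<Gamma> \<in> sets borel"
  shows "prob_space (distr \<mu> borel fin_part)"
    and "AE z in distr \<mu> borel fin_part. z \<in> \<Gamma>"
    and "\<And>E. E \<in> sets borel \<Longrightarrow> E \<subseteq> \<Gamma> \<Longrightarrow> measure (distr \<mu> borel fin_part) E = measure \<mu> (Fin ` E)"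
    and "\<And>(v :: rsphere \<Rightarrow> real) g. g \<in> borel_measurable borel \<Longrightarrow> (\<And>z. z \<in> \<Gamma> \<Longrightarrow> v (Fin z) = g z) \<Longrightarrow>
      (LINT x:Fin ` \<Gamma>|\<mu>. v x) = (\<integral>z. g z \<partial>distr \<mu> borel fin_part)"
proof -
  interpret prob_space \<mu> by fact
  have space: "space \<mu> = UNIV" using sets_eq_imp_space_eq[OF \<mu>(2)] by simp
  have meas: "fin_part \<in> measurable \<mu> borel"
    using measurable_fin_part \<mu>(2) by (simp cong: measurable_cong_sets)
  show "prob_space (distr \<mu> borel fin_part)" by (rule prob_space_distr[OF meas])
  have F: "Fin ` \<Gamma> \<in> sets \<mu>" using Fin_image_borel[OF \<Gamma>] \<mu>(2) by simp
  then have AE: "AE x in \<mu>. x \<in> Fin ` \<Gamma>"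
    using \<mu>(3) by (subst AE_in_set_eq_1) (auto simp: measure_def)
  show "AE z in distr \<mu> borel fin_part. z \<in> \<Gamma>"
    using AE by (subst AE_distr_iff[OF meas]) (use \<Gamma> in auto)
  show "measure (distr \<mu> borel fin_part) E = measure \<mu> (Fin ` E)" if E: "E \<in> sets borel" "E \<subseteq> \<Gamma>" for E
  proof -
    have "measure (distr \<mu> borel fin_part) E = measure \<mu> (fin_part -` E \<inter> space \<mu>)"
      by (rule measure_distr[OF meas E(1)])
    also have "\<dots> = measure \<mu> (Fin ` E)"
    proof (rule measure_eq_AE)
      show "AE x in \<mu>. x \<in> fin_part -` E \<inter> space \<mu> \<longleftrightarrow> x \<in> Fin ` E"
        using AE by eventually_elim (auto simp: space)
      show "fin_part -` E \<inter> space \<mu> \<in> sets \<mu>" using meas E(1) by (rule measurable_sets)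
      show "Fin ` E \<in> sets \<mu>" using Fin_image_borel[OF E(1)] \<mu>(2) by simp
    qed
    finally show ?thesis .
  qed
  show "(LINT x:Fin ` \<Gamma>|\<mu>. v x) = (\<integral>z. g z \<partial>distr \<mu> borel fin_part)"
    if g: "g \<in> borel_measurable borel" "\<And>z. z \<in> \<Gamma> \<Longrightarrow> v (Fin z) = g z"
    for v :: "rsphere \<Rightarrow> real" and g
  proof -
    have *: "indicat_real (Fin ` \<Gamma>) x *\<^sub>R v x = indicat_real (Fin ` \<Gamma>) x *\<^sub>R g (fin_part x)" for x
      using g(2) by (auto simp: indicator_def)
    have gm: "(\<lambda>x. g (fin_part x)) \<in> borel_measurable \<mu>"
      using measurable_compose[OF meas g(1)] .
    have "(LINT x:Fin ` \<Gamma>|\<mu>. v x) = (\<integral>x. indicat_real (Fin ` \<Gamma>) x *\<^sub>R g (fin_part x) \<partial>\<mu>)"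
      unfolding set_lebesgue_integral_def * ..
    also have "\<dots> = (\<integral>x. g (fin_part x) \<partial>\<mu>)"
    proof (rule integral_cong_AE)
      show "AE x in \<mu>. indicat_real (Fin ` \<Gamma>) x *\<^sub>R g (fin_part x) = g (fin_part x)"
        using AE by eventually_elim auto
    qed (use gm F in \<open>auto intro!: borel_measurable_scaleR\<close>)
    also have "\<dots> = (\<integral>z. g z \<partial>distr \<mu> borel fin_part)"
      by (rule integral_distr[OF meas g(1), symmetric])
    finally show ?thesis .
  qed
qed

text \<open>In effect this is integration against one common sum measure. Instead of constructing
  that measure, the induction over nonnegative Borel functions runs on both finite sums at
  once.\<close>

lemma sum_nn_integral_eq:
  fixes M :: "'a \<Rightarrow> 'b::topological_space measure" and N :: "'c \<Rightarrow> 'b measure"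
  assumes M: "\<And>i. i \<in> I \<Longrightarrow> sets (M i) = sets borel" and N: "\<And>j. j \<in> J \<Longrightarrow> sets (N j) = sets borel"
    and fin: "finite I" "finite J"
    and eq: "\<And>E. E \<in> sets borel \<Longrightarrow> (\<Sum>i\<in>I. emeasure (M i) E) = (\<Sum>j\<in>J. emeasure (N j) E)"
    and f: "f \<in> borel_measurable borel"
  shows "(\<Sum>i\<in>I. \<integral>\<^sup>+x. f x \<partial>M i) = (\<Sum>j\<in>J. \<integral>\<^sup>+x. f x \<partial>N j)"
proof -
  have mM: "g \<in> borel_measurable (M i)" if "g \<in> borel_measurable borel" "i \<in> I" for g :: "'b \<Rightarrow> ennreal" and i
    using that M by (simp cong: measurable_cong_sets)
  have mN: "g \<in> borel_measurable (N j)" if "g \<in> borel_measurable borel" "j \<in> J" for g :: "'b \<Rightarrow> ennreal" and j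
    using that N by (simp cong: measurable_cong_sets)
  from f show ?thesis
  proof (induction rule: borel_measurable_induct)
    case (cong f g)
    then have "f = g" by auto
    with cong show ?case by simp
  next
    case (set A)
    then show ?case using eq[of A] M N by simp
  next
    case (mult u c)
    then show ?case by (simp add: nn_integral_cmult mM mN flip: sum_distrib_left)
  next
    case (add u v)
    then show ?case by (simp add: nn_integral_add mM mN sum.distrib)
  next
    case (seq U)
    \<comment> \<open>Stated for a generic family so that it serves both sides. The supremum leaves
      the finite sum because each sequence of integrals is increasing.\<close>
    have *: "(\<Sum>i\<in>K. \<integral>\<^sup>+x. (SUP k. U k) x \<partial>L i) = (SUP k. \<Sum>i\<in>K. \<integral>\<^sup>+x. U k x \<partial>L i)"
      if "finite K" "\<And>i. i \<in> K \<Longrightarrow> sets (L i) = sets borel" for K :: "'k set" and L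
    proof -
      have "(\<integral>\<^sup>+x. (SUP k. U k) x \<partial>L i) = (SUP k. \<integral>\<^sup>+x. U k x \<partial>L i)" if i: "i \<in> K" for i
        unfolding SUP_apply using seq \<open>i \<in> K\<close> that(1)
        by (intro nn_integral_monotone_convergence_SUP) (auto simp: \<open>\<And>i. i \<in> K \<Longrightarrow> sets (L i) = sets borel\<close> cong: measurable_cong_sets)
      then have "(\<Sum>i\<in>K. \<integral>\<^sup>+x. (SUP k. U k) x \<partial>L i) = (\<Sum>i\<in>K. SUP k. \<integral>\<^sup>+x. U k x \<partial>L i)" by simp
      also have "\<dots> = (SUP k. \<Sum>i\<in>K. \<integral>\<^sup>+x. U k x \<partial>L i)"
        using seq by (intro ennreal_SUP_sum[symmetric]) (auto simp: incseq_def le_fun_def intro!: nn_integral_mono)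
      finally show ?thesis .
    qed
    show ?case using *[OF fin(1) M] *[OF fin(2) N] seq by simp
  qed
qed

lemma sum_integral_eq:
  fixes M :: "'a \<Rightarrow> 'b::topological_space measure" and N :: "'c \<Rightarrow> 'b measure" and f :: "'b \<Rightarrow> real"
  assumes M: "\<And>i. i \<in> I \<Longrightarrow> sets (M i) = sets borel" and N: "\<And>j. j \<in> J \<Longrightarrow> sets (N j) = sets borel"
    and fin: "finite I" "finite J"
    and eq: "\<And>E. E \<in> sets borel \<Longrightarrow> (\<Sum>i\<in>I. emeasure (M i) E) = (\<Sum>j\<in>J. emeasure (N j) E)"
    and f: "f \<in> borel_measurable borel"
    and int: "\<And>i. i \<in> I \<Longrightarrow> integrable (M i) f" "\<And>j. j \<in> J \<Longrightarrow> integrable (N j) f"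
  shows "(\<Sum>i\<in>I. \<integral>x. f x \<partial>M i) = (\<Sum>j\<in>J. \<integral>x. f x \<partial>N j)"
proof -
  have *: "(\<Sum>i\<in>I. \<integral>x. g x \<partial>M i) = (\<Sum>j\<in>J. \<integral>x. g x \<partial>N j)"
    if g: "g \<in> borel_measurable borel" "\<And>x. g x \<ge> 0" and
      "\<And>i. i \<in> I \<Longrightarrow> integrable (M i) g" "\<And>j. j \<in> J \<Longrightarrow> integrable (N j) g" for g :: "'b \<Rightarrow> real"
  proof -
    have "ennreal (\<Sum>i\<in>I. \<integral>x. g x \<partial>M i) = (\<Sum>i\<in>I. \<integral>\<^sup>+x. ennreal (g x) \<partial>M i)"
      using that by (simp add: nn_integral_eq_integral flip: sum_ennreal)
    also have "\<dots> = (\<Sum>j\<in>J. \<integral>\<^sup>+x. ennreal (g x) \<partial>N j)"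
      using g(1) by (intro sum_nn_integral_eq M N fin eq) auto
    also have "\<dots> = ennreal (\<Sum>j\<in>J. \<integral>x. g x \<partial>N j)"
      using that by (simp add: nn_integral_eq_integral flip: sum_ennreal)
    finally show ?thesis using g(2) by (simp add: sum_nonneg)
  qed
  have split: "(\<integral>x. f x \<partial>L) = (\<integral>x. max 0 (f x) \<partial>L) - (\<integral>x. max 0 (- f x) \<partial>L)" if "integrable L f" for L
  proof -
    have "(\<integral>x. f x \<partial>L) = (\<integral>x. max 0 (f x) - max 0 (- f x) \<partial>L)"
      by (intro Bochner_Integration.integral_cong) auto
    then show ?thesis using that by simp
  qed
  have "(\<Sum>i\<in>I. \<integral>x. max 0 (f x) \<partial>M i) = (\<Sum>j\<in>J. \<integral>x. max 0 (f x) \<partial>N j)"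
    using f int by (intro *) auto
  moreover have "(\<Sum>i\<in>I. \<integral>x. max 0 (- f x) \<partial>M i) = (\<Sum>j\<in>J. \<integral>x. max 0 (- f x) \<partial>N j)"
    using f int by (intro *) auto
  ultimately show ?thesis
    using split int by (simp add: sum_subtractf)
qed

section \<open>Logarithmic potentials at the boundary\<close>

lemma measurable_ln_norm_diff [measurable]:
  "(\<lambda>z. ln (cmod (w - z))) \<in> borel_measurable borel"
  by measurable

lemma integrable_ln_norm_off_support:
  assumes "prob_space m" "sets m = sets borel" "AE z in m. z \<in> B" "compact B" "w \<notin> B"
  shows "integrable m (\<lambda>z. ln (cmod (w - z)))"
proof -
  interpret prob_space m by fact
  have "continuous_on B (\<lambda>z. ln (cmod (w - z)))"
    using assms(5) by (intro continuous_intros) auto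
  then have "bounded ((\<lambda>z. ln (cmod (w - z))) ` B)"
    using assms(4) by (intro compact_imp_bounded compact_continuous_image)
  then obtain K where K: "\<And>z. z \<in> B \<Longrightarrow> \<bar>ln (cmod (w - z))\<bar> \<le> K"
    unfolding bounded_iff by auto
  have "AE z in m. norm (ln (cmod (w - z))) \<le> K"
    using assms(3) by eventually_elim (use K in auto)
  moreover have "(\<lambda>z. ln (cmod (w - z))) \<in> borel_measurable m"
    using assms(2) by (simp cong: measurable_cong_sets)
  ultimately show ?thesis by (rule integrable_const_bound)
qed

text \<open>One bound for the sequence and its limit: subtracting from ln R makes the kernels
  nonnegative, and R at least 1 gives ln R the sign needed in a dominating function.\<close>

lemma bounded_norm_diff_seq:
  fixes x :: "nat \<Rightarrow> complex"
  assumes "bounded B" "x \<longlonglongrightarrow> w0"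
  obtains R where "R \<ge> 1" "\<And>n z. z \<in> B \<Longrightarrow> cmod (x n - z) \<le> R" "\<And>z. z \<in> B \<Longrightarrow> cmod (w0 - z) \<le> R"
proof -
  obtain b where b: "\<And>z. z \<in> B \<Longrightarrow> cmod z \<le> b" using assms(1) unfolding bounded_iff by auto
  obtain a where a: "\<And>n. cmod (x n) \<le> a"
    using convergent_imp_bounded[OF assms(2)] unfolding bounded_iff by auto
  have a': "cmod w0 \<le> a" using a Lim_bounded[OF tendsto_norm[OF assms(2)], of 0] by simp
  show thesis
  proof (rule that[of "max 1 (a + b)"])
    fix n z assume z: "z \<in> B"
    show "cmod (x n - z) \<le> max 1 (a + b)" "cmod (w0 - z) \<le> max 1 (a + b)"
      using norm_triangle_ineq4[of "x n" z] norm_triangle_ineq4[of w0 z] a[of n] a' b[OF z] by auto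
  qed simp
qed

text \<open>As \<open>ln 0 = 0\<close>, integrability does not by itself exclude an atom at \<open>w0\<close>.\<close>

lemma integrable_ln_norm_boundary:
  assumes m: "prob_space m" "sets m = sets borel" "AE z in m. z \<in> B" "compact B"
    and x: "\<And>n. x n \<notin> B" "x \<longlonglongrightarrow> w0" "(\<lambda>n. \<integral>z. ln (cmod (x n - z)) \<partial>m) \<longlonglongrightarrow> L"
  shows "integrable m (\<lambda>z. ln (cmod (w0 - z)))" "AE z in m. z \<noteq> w0"
proof -
  interpret prob_space m by fact
  obtain R where R: "R \<ge> 1" "\<And>n z. z \<in> B \<Longrightarrow> cmod (x n - z) \<le> R" "\<And>z. z \<in> B \<Longrightarrow> cmod (w0 - z) \<le> R"
    using bounded_norm_diff_seq[OF compact_imp_bounded[OF m(4)] x(2)] by metis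
  \<comment> \<open>The shift by ln R makes the real expression nonnegative for \<open>z\<close> in
    \<open>B\<close>, so \<open>ennreal\<close> truncates nothing there and Fatou's lemma
    applies.\<close>
  define f where "f n z = ennreal (ln R - ln (cmod (x n - z)))" for n z
  have meas: "g \<in> borel_measurable m" if "g \<in> borel_measurable borel" for g :: "complex \<Rightarrow> 'q::topological_space"
    using that m(2) by (simp cong: measurable_cong_sets)
  have "(\<integral>\<^sup>+z. f n z \<partial>m) = ennreal (ln R - (\<integral>z. ln (cmod (x n - z)) \<partial>m))" for n
  proof -
    note i = integrable_ln_norm_off_support[OF m x(1)[of n]]
    have "AE z in m. 0 \<le> ln R - ln (cmod (x n - z))"
      using m(3)
    proof eventually_elim
      case (elim z)
      then have "0 < cmod (x n - z)" using x(1)[of n] by auto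
      then show ?case using R(2)[OF elim, of n] by (simp add: ln_mono)
    qed
    then have "(\<integral>\<^sup>+z. f n z \<partial>m) = ennreal (\<integral>z. ln R - ln (cmod (x n - z)) \<partial>m)"
      unfolding f_def using i by (intro nn_integral_eq_integral) auto
    then show ?thesis using i by (simp add: prob_space)
  qed
  moreover have "(\<lambda>n. ennreal (ln R - (\<integral>z. ln (cmod (x n - z)) \<partial>m))) \<longlonglongrightarrow> ennreal (ln R - L)"
    using x(3) by (intro tendsto_intros)
  ultimately have "(\<lambda>n. \<integral>\<^sup>+z. f n z \<partial>m) \<longlonglongrightarrow> ennreal (ln R - L)" by simp
  then have "liminf (\<lambda>n. \<integral>\<^sup>+z. f n z \<partial>m) = ennreal (ln R - L)"
    using lim_imp_Liminf trivial_limit_sequentially by blast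
  moreover have fm: "f n \<in> borel_measurable m" for n
    unfolding f_def by (intro meas) measurable
  ultimately have fatou: "(\<integral>\<^sup>+z. liminf (\<lambda>n. f n z) \<partial>m) \<le> ennreal (ln R - L)"
    using nn_integral_liminf[of f m] by simp
  have fin: "AE z in m. liminf (\<lambda>n. f n z) \<noteq> \<infinity>"
    using fm fatou by (intro nn_integral_PInf_AE) (auto simp: top_unique)
  \<comment> \<open>At \<open>w0\<close> itself the functions tend to infinity, so an atom there
    would contradict the finite bound from Fatou's lemma.\<close>
  have "liminf (\<lambda>n. f n w0) = \<infinity>" if "w0 \<in> B"
  proof -
    have "filterlim (\<lambda>n. cmod (x n - w0)) (at_right 0) sequentially"
      using x(1,2) that unfolding filterlim_at
      by (auto intro!: tendsto_norm_zero LIM_zero eventuallyI)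
    then have "filterlim (\<lambda>n. ln (cmod (x n - w0))) at_bot sequentially"
      using ln_at_0 filterlim_compose by blast
    then have "filterlim (\<lambda>n. ln R - ln (cmod (x n - w0))) at_top sequentially"
      unfolding diff_conv_add_uminus
      by (intro filterlim_tendsto_add_at_top[OF tendsto_const]) (simp add: filterlim_uminus_at_top)
    then have "(\<lambda>n. f n w0) \<longlonglongrightarrow> \<infinity>"
      unfolding f_def infinity_ennreal_def ennreal_tendsto_top_eq_at_top .
    then show ?thesis using lim_imp_Liminf trivial_limit_sequentially by blast
  qed
  with fin m(3) show ne: "AE z in m. z \<noteq> w0" by (auto elim: AE_mp)
  have "AE z in m. liminf (\<lambda>n. f n z) = ennreal (ln R - ln (cmod (w0 - z)))"
    using ne
  proof eventually_elim
    case (elim z)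
    then have "(\<lambda>n. f n z) \<longlonglongrightarrow> ennreal (ln R - ln (cmod (w0 - z)))"
      unfolding f_def using x(2) by (intro tendsto_intros) auto
    then show ?case using lim_imp_Liminf trivial_limit_sequentially by blast
  qed
  then have "(\<integral>\<^sup>+z. ennreal (ln R - ln (cmod (w0 - z))) \<partial>m) = (\<integral>\<^sup>+z. liminf (\<lambda>n. f n z) \<partial>m)"
    by (intro nn_integral_cong_AE) auto
  then have lt: "(\<integral>\<^sup>+z. ennreal (ln R - ln (cmod (w0 - z))) \<partial>m) < \<infinity>"
    using fatou by (simp add: le_less_trans[OF _ ennreal_less_top])
  have "AE z in m. 0 \<le> ln R - ln (cmod (w0 - z))"
    using ne m(3)
  proof eventually_elim
    case (elim z) then show ?case using R(3)[of z] R(1) by simp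
  qed
  then have "integrable m (\<lambda>z. ln R - ln (cmod (w0 - z)))"
    using lt by (intro integrableI_nonneg meas) measurable
  then have "integrable m (\<lambda>z. ln R - (ln R - ln (cmod (w0 - z))))"
    by (rule Bochner_Integration.integrable_diff[OF integrable_const])
  then show "integrable m (\<lambda>z. ln (cmod (w0 - z)))" by simp
qed

text \<open>Dominated convergence. The comparison of distances bounds ln |x n - z| below by ln |w0 -
  z| - ln 3, and boundedness of \<open>B\<close> bounds it above by ln R.\<close>

lemma potential_normal_limit:
  assumes m: "prob_space m" "sets m = sets borel" "AE z in m. z \<in> B" "bounded B"
    and w0: "integrable m (\<lambda>z. ln (cmod (w0 - z)))" "AE z in m. z \<noteq> w0"
    and x: "x \<longlonglongrightarrow> w0" "\<And>n z. z \<in> B \<Longrightarrow> cmod (z - w0) \<le> 3 * cmod (z - x n)"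
  shows "(\<lambda>n. \<integral>z. ln (cmod (x n - z)) \<partial>m) \<longlonglongrightarrow> (\<integral>z. ln (cmod (w0 - z)) \<partial>m)"
proof -
  interpret prob_space m by fact
  obtain R where R: "R \<ge> 1" "\<And>n z. z \<in> B \<Longrightarrow> cmod (x n - z) \<le> R"
    using bounded_norm_diff_seq[OF m(4) x(1)] by metis
  have meas: "g \<in> borel_measurable m" if "g \<in> borel_measurable borel" for g :: "complex \<Rightarrow> real"
    using that m(2) by (simp cong: measurable_cong_sets)
  show ?thesis
  proof (rule integral_dominated_convergence)
    show "integrable m (\<lambda>z. \<bar>ln (cmod (w0 - z))\<bar> + (ln 3 + ln R))" using w0(1) by auto
    show "AE z in m. (\<lambda>n. ln (cmod (x n - z))) \<longlonglongrightarrow> ln (cmod (w0 - z))"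
      using w0(2)
    proof eventually_elim
      case (elim z) then show ?case using x(1) by (intro tendsto_intros) auto
    qed
    fix n
    show "AE z in m. norm (ln (cmod (x n - z))) \<le> \<bar>ln (cmod (w0 - z))\<bar> + (ln 3 + ln R)"
      using m(3) w0(2)
    proof eventually_elim
      case (elim z)
      then have a: "0 < cmod (w0 - z)" by simp
      have b: "cmod (w0 - z) \<le> 3 * cmod (x n - z)"
        using x(2)[OF elim(1), of n] by (simp add: norm_minus_commute)
      then have c: "0 < cmod (x n - z)" using a by linarith
      have "ln (cmod (w0 - z)) \<le> ln (3 * cmod (x n - z))" using a b c by (subst ln_le_cancel_iff) auto
      also have "\<dots> = ln 3 + ln (cmod (x n - z))" using c by (subst ln_mult) auto
      finally have 1: "ln (cmod (w0 - z)) \<le> ln 3 + ln (cmod (x n - z))" .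
      have 2: "ln (cmod (x n - z)) \<le> ln R" using c R elim by (intro ln_mono) auto
      have "ln R \<ge> 0" "ln (3::real) \<ge> 0" using R by auto
      with 1 2 show ?case unfolding real_norm_def by linarith
    qed
  qed (auto intro!: meas)
qed

text \<open>The potential \<open>V\<close> of the family \<open>m\<close> is evaluated at a boundary
  point twice: from \<open>W\<close> by \<open>out\<close>, and from inside the curves by
  \<open>ins\<close> after passing to the family \<open>n\<close>. The functions \<open>L j\<close>
  stand for ln |w - \<zeta> j|, with the zeros at infinity included.\<close>

lemma boundary_log_identity:
  fixes I :: "'i set" and J :: "'j set" and a :: "'i \<Rightarrow> complex" and L :: "'j \<Rightarrow> complex \<Rightarrow> real"
  assumes fin: "finite I" "finite J"
    and \<gamma>: "\<And>i. i \<in> I \<Longrightarrow> analytic_Jordan_curve (\<gamma> i)" "disjoint_family_on \<gamma> I" "B = (\<Union>i\<in>I. \<gamma> i)"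
    and W: "open W" "frontier W = B" "\<And>i. i \<in> I \<Longrightarrow> inside (\<gamma> i) \<inter> B = {}"
    and a: "\<And>i. i \<in> I \<Longrightarrow> a i \<in> inside (\<gamma> i)"
    and m: "\<And>i. i \<in> I \<Longrightarrow> prob_space (m i)" "\<And>i. i \<in> I \<Longrightarrow> sets (m i) = sets borel"
      "\<And>i. i \<in> I \<Longrightarrow> AE z in m i. z \<in> B"
    and n: "\<And>j. j \<in> J \<Longrightarrow> prob_space (n j)" "\<And>j. j \<in> J \<Longrightarrow> sets (n j) = sets borel"
      "\<And>j. j \<in> J \<Longrightarrow> AE z in n j. z \<in> B"
    and mn: "\<And>E. E \<in> sets borel \<Longrightarrow> (\<Sum>i\<in>I. emeasure (m i) E) = (\<Sum>j\<in>J. emeasure (n j) E)"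
    and out: "\<And>i w. i \<in> I \<Longrightarrow> w \<in> W \<Longrightarrow> (\<integral>z. ln (cmod (w - z)) \<partial>m i) = ln (cmod (w - a i))"
    and ins: "\<And>j w w'. j \<in> J \<Longrightarrow> w \<in> (\<Union>i\<in>I. inside (\<gamma> i)) \<Longrightarrow> w' \<in> (\<Union>i\<in>I. inside (\<gamma> i)) \<Longrightarrow>
      (\<integral>z. ln (cmod (w - z)) - ln (cmod (w' - z)) \<partial>n j) = L j w - L j w'"
    and L: "\<And>j w. j \<in> J \<Longrightarrow> w \<in> B \<Longrightarrow> isCont (L j) w"
  obtains C where "\<And>w. w \<in> B \<Longrightarrow> (\<Sum>i\<in>I. ln (cmod (w - a i))) = (\<Sum>j\<in>J. L j w) + C"
proof (cases "I = {}")
  case True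
  then show ?thesis using that \<gamma>(3) by auto
next
  case False
  then obtain i0 where i0: "i0 \<in> I" by blast
  \<comment> \<open>A single base point for all curves: since \<open>ins\<close> allows
    \<open>w\<close> and \<open>w'\<close> inside different curves, the resulting constant does not
    depend on the curve.\<close>
  define q where "q = a i0"
  define V where "V w = (\<Sum>i\<in>I. \<integral>z. ln (cmod (w - z)) \<partial>m i)" for w
  let ?G = "\<Union>i\<in>I. inside (\<gamma> i)"
  have q: "q \<in> ?G" using i0 a by (auto simp: q_def)
  have cpt: "compact B" using \<gamma>(1,3) fin analytic_Jordan_curve_inside(1) by (auto intro!: compact_UN)
  have GB: "?G \<inter> B = {}" using W(3) by blast
  have WB: "W \<inter> B = {}" using W(1,2) by (auto simp: frontier_def interior_open)
  have Vq: "V w = V q + (\<Sum>j\<in>J. L j w - L j q)" if w: "w \<in> ?G" for w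
  proof -
    have nB: "w \<notin> B" "q \<notin> B" using w q GB by blast+
    note im = integrable_ln_norm_off_support[OF m cpt]
    note in' = integrable_ln_norm_off_support[OF n cpt]
    have "V w - V q = (\<Sum>i\<in>I. \<integral>z. ln (cmod (w - z)) - ln (cmod (q - z)) \<partial>m i)"
      unfolding V_def by (simp add: im nB flip: sum_subtractf)
    also have "\<dots> = (\<Sum>j\<in>J. \<integral>z. ln (cmod (w - z)) - ln (cmod (q - z)) \<partial>n j)"
      by (rule sum_integral_eq[OF m(2) n(2) fin mn]) (use im in' nB in auto)
    also have "\<dots> = (\<Sum>j\<in>J. L j w - L j q)" by (simp add: ins[OF _ w q])
    finally show ?thesis by simp
  qed
  show ?thesis
  proof (rule that[of "V q - (\<Sum>j\<in>J. L j q)"])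
    fix w0 assume w0: "w0 \<in> B"
    then obtain i where i: "i \<in> I" "w0 \<in> \<gamma> i" using \<gamma>(3) by blast
    have sub: "\<gamma> i \<subseteq> B" using i \<gamma>(3) by blast
    have "B - \<gamma> i = (\<Union>k\<in>I - {i}. \<gamma> k)"
      using \<gamma>(2,3) i(1) unfolding disjoint_family_on_def by blast
    then have cl: "closed (B - \<gamma> i)"
      using fin \<gamma>(1) analytic_Jordan_curve_inside(1) by (auto intro!: closed_UN compact_imp_closed)
    have fr: "frontier (inside (\<gamma> i)) = \<gamma> i" by (rule analytic_Jordan_curve_inside[OF \<gamma>(1)[OF i(1)]])
    obtain x where x: "\<And>n. x n \<in> W" "x \<longlonglongrightarrow> w0" "\<And>n z. z \<in> B \<Longrightarrow> cmod (z - w0) \<le> 3 * cmod (z - x n)"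
      using analytic_curve_normal_approach[OF \<gamma>(1)[OF i(1)] i(2) cl sub, of W] WB W(2) w0
      by (metis DiffD1 frontier_def order_refl)
    obtain y where y: "\<And>n. y n \<in> inside (\<gamma> i)" "y \<longlonglongrightarrow> w0" "\<And>n z. z \<in> B \<Longrightarrow> cmod (z - w0) \<le> 3 * cmod (z - y n)"
      using analytic_curve_normal_approach[OF \<gamma>(1)[OF i(1)] i(2) cl sub, of "inside (\<gamma> i)"] W(3)[OF i(1)] fr sub i(2)
      by (metis DiffD1 frontier_def)
    have ne: "w0 \<noteq> a k" if "k \<in> I" for k using a that GB w0 by blast
    have lim: "(\<lambda>n. ln (cmod (x n - a k))) \<longlonglongrightarrow> ln (cmod (w0 - a k))" if "k \<in> I" for k
      using ne[OF that] x(2) by (intro tendsto_intros) auto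
    \<comment> \<open>The explicit potential of each single \<open>m k\<close> in \<open>W\<close>
      provides the convergent sequence that Fatou's lemma needs; its limit is finite because
      \<open>a k\<close> is not on the boundary.\<close>
    have int: "integrable (m k) (\<lambda>z. ln (cmod (w0 - z)))" "AE z in m k. z \<noteq> w0" if k: "k \<in> I" for k
      using integrable_ln_norm_boundary[OF m(1-3)[OF k] cpt _ x(2)] lim[OF k] x(1) WB out[OF k x(1)] by auto
    note plim = potential_normal_limit[OF m compact_imp_bounded[OF cpt] int]
    have "(\<lambda>n. \<Sum>k\<in>I. ln (cmod (x n - a k))) \<longlonglongrightarrow> V w0"
      unfolding V_def using plim[OF _ _ _ _ _ x(2,3)] by (intro tendsto_sum) (simp add: out x(1))
    moreover have "(\<lambda>n. \<Sum>k\<in>I. ln (cmod (x n - a k))) \<longlonglongrightarrow> (\<Sum>k\<in>I. ln (cmod (w0 - a k)))"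
      by (intro tendsto_sum lim)
    ultimately have 1: "V w0 = (\<Sum>k\<in>I. ln (cmod (w0 - a k)))" using LIMSEQ_unique by blast
    \<comment> \<open>Integrability at \<open>w0\<close>, obtained from the other side of the curve,
      is reused for the approach from inside.\<close>
    have "(\<lambda>n. V (y n)) \<longlonglongrightarrow> V w0"
      unfolding V_def using plim[OF _ _ _ _ _ y(2,3)] by (intro tendsto_sum) simp
    moreover have "(\<lambda>n. V (y n)) \<longlonglongrightarrow> V q + (\<Sum>j\<in>J. L j w0 - L j q)"
    proof -
      have "V (y n) = V q + (\<Sum>j\<in>J. L j (y n) - L j q)" for n
        using Vq i(1) y(1) by blast
      moreover have "(\<lambda>n. V q + (\<Sum>j\<in>J. L j (y n) - L j q)) \<longlonglongrightarrow> V q + (\<Sum>j\<in>J. L j w0 - L j q)"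
        using L w0 y(2) by (intro tendsto_intros isCont_tendsto_compose[of w0 "L _"])
      ultimately show ?thesis by simp
    qed
    ultimately have "V w0 = V q + (\<Sum>j\<in>J. L j w0 - L j q)" using LIMSEQ_unique by blast
    with 1 show "(\<Sum>i\<in>I. ln (cmod (w0 - a i))) = (\<Sum>j\<in>J. L j w0) + (V q - (\<Sum>j\<in>J. L j q))"
      by (simp add: sum_subtractf)
  qed
qed

section \<open>A coordinate centred at infinity\<close>

text \<open>The inverse of the coordinate 1 / (z - q). For a centre q off the closure of \<Omega> it
  covers all of \<Omega>, including \<open>Infty\<close>, and \<Omega> becomes bounded; q = 0 gives
  back \<open>chart_inf\<close>.\<close>

definition sphere_coord :: "complex \<Rightarrow> complex \<Rightarrow> rsphere" where
  "sphere_coord q w = (if w = 0 then Infty else Fin (q + inverse w))"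

lemma chart_inf_eq_sphere_coord: "chart_inf = sphere_coord 0"
  by (auto simp: chart_inf_def sphere_coord_def)

lemma open_sphere_coord_vimage:
  assumes U: "open U" shows "open (sphere_coord q -` U)"
proof (rule Topological_Spaces.openI)
  fix w assume w: "w \<in> sphere_coord q -` U"
  show "\<exists>T. open T \<and> w \<in> T \<and> T \<subseteq> sphere_coord q -` U"
  proof (cases "w = 0")
    case False
    let ?T = "- {0} \<inter> (\<lambda>w. q + inverse w) -` (Fin -` U)"
    have "open ?T" by (intro continuous_open_preimage open_Fin_vimage U continuous_intros) auto
    moreover have "w \<in> ?T" "?T \<subseteq> sphere_coord q -` U"
      using w False by (auto simp: sphere_coord_def)
    ultimately show ?thesis by blast
  next
    case True
    then have inf: "Infty \<in> U" using w by (simp add: sphere_coord_def)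
    obtain R where R: "R > 0" "\<And>z. Fin z \<notin> U \<Longrightarrow> cmod z \<le> R"
      using bounded_Compl_Fin_vimage[OF U inf] unfolding bounded_pos by auto
    \<comment> \<open>If |t| is below this radius, then |1 / t| exceeds R + |q|, so q + 1 / t has
      modulus greater than R and lies in the neighbourhood of infinity.\<close>
    have "ball 0 (inverse (R + cmod q)) \<subseteq> sphere_coord q -` U"
    proof
      fix t :: complex assume t: "t \<in> ball 0 (inverse (R + cmod q))"
      show "t \<in> sphere_coord q -` U"
      proof (cases "t = 0")
        case False
        have p: "R + cmod q > 0" using R(1) by (simp add: add_pos_nonneg)
        have "R + cmod q < cmod (inverse t)"
          using less_imp_inverse_less[of "cmod t" "inverse (R + cmod q)"] t False p by (simp add: norm_inverse)
        then have "R < cmod (q + inverse t)"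
          using norm_diff_ineq[of "inverse t" q] by (simp add: add.commute)
        then show ?thesis using R(2)[of "q + inverse t"] False by (auto simp: sphere_coord_def)
      qed (use inf in \<open>simp add: sphere_coord_def\<close>)
    qed
    then show ?thesis using True R(1) by (intro exI[of _ "ball 0 (inverse (R + cmod q))"]) (auto simp: add_pos_nonneg)
  qed
qed

text \<open>Each chart has its own zero-free function, because near infinity the expression in z
  must be rewritten in t = 1 / z before it is visibly holomorphic at t = 0.\<close>

lemma sphere_subharmonic_on_ln_norm:
  assumes "open G" "F0 holomorphic_on Fin -` G" "F1 holomorphic_on chart_inf -` G"
    and "\<And>z. Fin z \<in> G \<Longrightarrow> F0 z \<noteq> 0" "\<And>t. chart_inf t \<in> G \<Longrightarrow> F1 t \<noteq> 0"
    and "\<And>z. Fin z \<in> G \<Longrightarrow> v (Fin z) = ln (cmod (F0 z))"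
    and "\<And>t. chart_inf t \<in> G \<Longrightarrow> v (chart_inf t) = ln (cmod (F1 t))"
  shows "sphere_subharmonic_on (\<lambda>x. ereal (v x)) G" "sphere_subharmonic_on (\<lambda>x. ereal (- v x)) G"
proof -
  have o: "open (chart_inf -` G)"
    unfolding chart_inf_eq_sphere_coord by (rule open_sphere_coord_vimage[OF assms(1)])
  have "sphere_subharmonic_on (\<lambda>x. ereal (c * v x)) G" for c
    unfolding sphere_subharmonic_on_def
    using assms o open_Fin_vimage[OF assms(1)]
    by (intro conjI subharmonic_on_ln_norm[of _ F0 _ c] subharmonic_on_ln_norm[of _ F1 _ c]) auto
  from this[of 1] this[of "-1"] show "sphere_subharmonic_on (\<lambda>x. ereal (v x)) G"
    "sphere_subharmonic_on (\<lambda>x. ereal (- v x)) G" by simp_all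
qed

text \<open>The pole \<open>w\<close> of the kernel lies outside the curve and off it, so the kernel
  is harmonic inside and continuous at the boundary.\<close>

lemma harmonic_measure_ln_norm_inside:
  assumes \<Omega>: "open \<Omega>" "connected \<Omega>" "Infty \<in> \<Omega>" and \<gamma>: "analytic_Jordan_curve \<gamma>" "Fin ` \<gamma> \<subseteq> frontier \<Omega>"
    and p: "a \<in> inside \<gamma>" and hm: "is_harmonic_measure (- closure \<Omega>) (Fin a) \<mu>"
    and w: "w \<notin> inside \<gamma>" "w \<notin> \<gamma>"
  shows "(LINT x:Fin ` \<gamma>|\<mu>. ln (cmod (w - fin_part x))) = ln (cmod (w - a))"
proof -
  note J = analytic_Jordan_curve_inside[OF \<gamma>(1)]
  let ?v = "\<lambda>x. ln (cmod (w - fin_part x))"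
  have comp: "connected_component_set (- closure \<Omega>) (Fin a) = Fin ` inside \<gamma>"
    using p by (intro component_inside[OF \<Omega> \<gamma>]) auto
  have t: "t \<noteq> 0 \<and> inverse t \<in> inside \<gamma>" if "chart_inf t \<in> Fin ` inside \<gamma>" for t
    using that by (auto simp: chart_inf_def split: if_splits)
  have hol: "(\<lambda>z. w - z) holomorphic_on Fin -` Fin ` inside \<gamma>"
    "(\<lambda>t. w - inverse t) holomorphic_on chart_inf -` Fin ` inside \<gamma>"
    using t by (auto intro!: holomorphic_intros)
  have o: "open (Fin ` inside \<gamma>)" using J(2) by simp
  have F0: "w - z \<noteq> 0" if "Fin z \<in> Fin ` inside \<gamma>" for z using that w(1) by auto
  have F1: "w - inverse t \<noteq> 0" if "chart_inf t \<in> Fin ` inside \<gamma>" for t using t[OF that] w(1) by auto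
  have v1: "?v (chart_inf t) = ln (cmod (w - inverse t))" if "chart_inf t \<in> Fin ` inside \<gamma>" for t
    using t[OF that] by (simp add: chart_inf_def)
  have v0: "?v (Fin z) = ln (cmod (w - z))" for z by simp
  note sub = sphere_subharmonic_on_ln_norm[OF o hol F0 F1 v0 v1]
  have fr: "frontier (Fin ` inside \<gamma>) = Fin ` \<gamma>" by (rule frontier_Fin_inside[OF \<gamma>(1)])
  have "(?v \<longlongrightarrow> ?v x) (nhds x)" if x: "x \<in> frontier (Fin ` inside \<gamma>)" for x
  proof -
    obtain z where z: "x = Fin z" "z \<in> \<gamma>" using x fr by auto
    have "isCont (?v \<circ> Fin) z"
      using z(2) w(2) by (auto simp: comp_def intro!: continuous_intros)
    from tendsto_nhds_FinI[OF this] show ?thesis by (simp add: z)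
  qed
  from harmonic_measure_integral[OF hm comp sub this] show ?thesis by (simp add: fr)
qed

text \<open>The value at \<open>Infty\<close> is chosen so that the differences
  \<open>ln_dist w x - ln_dist w' x\<close> are continuous there: they tend to 0.\<close>

definition ln_dist :: "complex \<Rightarrow> rsphere \<Rightarrow> real" where
  "ln_dist w x = (case x of Fin z \<Rightarrow> ln (cmod (w - z)) | Infty \<Rightarrow> 0)"

text \<open>A single logarithm has a pole at infinity, but in the difference the poles cancel: in t
  = 1 / z it is the logarithm of |(w t - 1) / (w' t - 1)|, which is regular at t = 0.\<close>

lemma harmonic_measure_ln_dist_outside:
  assumes \<Omega>: "open \<Omega>" "connected \<Omega>" "a \<in> \<Omega>" "Infty \<in> \<Omega>" and hm: "is_harmonic_measure \<Omega> a \<mu>"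
    and w: "Fin w \<notin> closure \<Omega>" "Fin w' \<notin> closure \<Omega>"
  shows "(LINT x:frontier \<Omega>|\<mu>. ln_dist w x - ln_dist w' x) = ln_dist w a - ln_dist w' a"
proof (rule harmonic_measure_integral[OF hm])
  have "connected_component_set \<Omega> a \<subseteq> \<Omega>" by (rule connected_component_subset)
  then show "connected_component_set \<Omega> a = \<Omega>"
    using \<Omega> connected_component_maximal[of a \<Omega> \<Omega>] by auto
  have ne: "z \<noteq> w" "z \<noteq> w'" if "Fin z \<in> \<Omega>" for z using that w closure_subset by auto
  then have ne': "w - z \<noteq> 0" "w' - z \<noteq> 0" if "Fin z \<in> \<Omega>" for z using that by force+
  have t: "(t = 0 \<and> Infty \<in> \<Omega>) \<or> (t \<noteq> 0 \<and> inverse t \<noteq> w \<and> inverse t \<noteq> w')" if "chart_inf t \<in> \<Omega>" for t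
    using that ne by (auto simp: chart_inf_def split: if_splits)
  have tne: "w * t - 1 \<noteq> 0" "w' * t - 1 \<noteq> 0" if "chart_inf t \<in> \<Omega>" for t
    using t[OF that] by (auto simp: field_simps)
  have teq: "ln_dist w (chart_inf t) - ln_dist w' (chart_inf t) = ln (cmod ((w * t - 1) / (w' * t - 1)))"
    if tt: "chart_inf t \<in> \<Omega>" for t
  proof (cases "t = 0")
    case False
    have "(w * t - 1) / (w' * t - 1) = (w - inverse t) / (w' - inverse t)"
      using False tne[OF tt] by (simp add: field_simps)
    moreover have "w - inverse t \<noteq> 0" "w' - inverse t \<noteq> 0" using t[OF tt] False by auto
    ultimately show ?thesis using False by (simp add: ln_dist_def chart_inf_def norm_divide ln_div)
  qed (simp add: ln_dist_def chart_inf_def)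
  have hol: "(\<lambda>z. (w - z) / (w' - z)) holomorphic_on Fin -` \<Omega>"
    "(\<lambda>t. (w * t - 1) / (w' * t - 1)) holomorphic_on chart_inf -` \<Omega>"
    using ne'(2) tne(2) by (auto intro!: holomorphic_intros simp del: right_minus_eq)
  have Feq: "ln_dist w (Fin z) - ln_dist w' (Fin z) = ln (cmod ((w - z) / (w' - z)))" if "Fin z \<in> \<Omega>" for z
    using ne[OF that] by (simp add: ln_dist_def norm_divide ln_div)
  have F0: "(w - z) / (w' - z) \<noteq> 0" if "Fin z \<in> \<Omega>" for z using ne'[OF that] by simp
  have F1: "(w * t - 1) / (w' * t - 1) \<noteq> 0" if "chart_inf t \<in> \<Omega>" for t using tne[OF that] by simp
  show "sphere_subharmonic_on (\<lambda>x. ereal (ln_dist w x - ln_dist w' x)) \<Omega>"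
    by (rule sphere_subharmonic_on_ln_norm(1)[OF \<Omega>(1) hol F0 F1 Feq teq])
  show "sphere_subharmonic_on (\<lambda>x. ereal (- (ln_dist w x - ln_dist w' x))) \<Omega>"
    by (rule sphere_subharmonic_on_ln_norm(2)[OF \<Omega>(1) hol F0 F1 Feq teq])
next
  fix x assume x: "x \<in> frontier \<Omega>"
  then have "x \<noteq> Infty" using \<Omega>(1,4) by (auto simp: frontier_def interior_open)
  then obtain z where z: "x = Fin z" by (cases x) auto
  then have "z \<noteq> w" "z \<noteq> w'" using x w by (auto simp: frontier_def)
  then have "isCont ((\<lambda>x. ln_dist w x - ln_dist w' x) \<circ> Fin) z"
    by (auto simp: comp_def ln_dist_def intro!: continuous_intros)
  from tendsto_nhds_FinI[OF this]
  show "((\<lambda>x. ln_dist w x - ln_dist w' x) \<longlongrightarrow> ln_dist w x - ln_dist w' x) (nhds x)" by (simp add: z)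
qed

section \<open>A maximum principle for zero-free functions\<close>

text \<open>The maximum principle for functions given only inside. A superlevel set with level
  between K and |F z| is compact because of the boundary limits, so the maximum is attained and F is
  constant. Then the superlevel set is all of S, and a bounded nonempty S would be both open and
  closed.\<close>

lemma norm_le_boundary_limit:
  fixes F :: "complex \<Rightarrow> complex"
  assumes S: "open S" "connected S" "bounded S" and F: "F holomorphic_on S"
    and bd: "\<And>x w. (\<And>n::nat. x n \<in> S) \<Longrightarrow> x \<longlonglongrightarrow> w \<Longrightarrow> w \<notin> S \<Longrightarrow> (\<lambda>n. cmod (F (x n))) \<longlonglongrightarrow> K"
    and z: "z \<in> S"
  shows "cmod (F z) \<le> K"
proof (rule ccontr)
  assume n: "\<not> cmod (F z) \<le> K"
  define M where "M = (K + cmod (F z)) / 2"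
  have M: "K < M" "M < cmod (F z)" using n by (simp_all add: M_def)
  define T where "T = {z\<in>S. cmod (F z) \<ge> M}"
  have cF: "isCont F w" if "w \<in> S" for w
    using F S(1) that by (meson continuous_on_eq_continuous_at holomorphic_on_imp_continuous_on)
  have "closed T"
    unfolding closed_sequential_limits
  proof (intro allI impI)
    fix x w assume x: "(\<forall>n. x n \<in> T) \<and> x \<longlonglongrightarrow> w"
    have "w \<in> S"
    proof (rule ccontr)
      assume "w \<notin> S"
      then have "(\<lambda>n. cmod (F (x n))) \<longlonglongrightarrow> K" using x by (intro bd) (auto simp: T_def)
      then have "M \<le> K" using x by (intro LIMSEQ_le_const) (auto simp: T_def)
      then show False using M by simp
    qed
    then have "(\<lambda>n. cmod (F (x n))) \<longlonglongrightarrow> cmod (F w)"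
      using x cF by (intro tendsto_intros isCont_tendsto_compose[of w F]) auto
    then have "M \<le> cmod (F w)" using x by (intro LIMSEQ_le_const) (auto simp: T_def)
    then show "w \<in> T" using \<open>w \<in> S\<close> by (simp add: T_def)
  qed
  then have T: "compact T" using S(3) by (auto simp: T_def compact_eq_bounded_closed intro: bounded_subset)
  moreover have zT: "z \<in> T" using z M by (simp add: T_def)
  moreover have "continuous_on T (\<lambda>w. cmod (F w))"
    using F by (auto simp: T_def intro!: continuous_intros
      intro: continuous_on_subset[OF holomorphic_on_imp_continuous_on])
  ultimately obtain z1 where z1: "z1 \<in> T" "\<And>w. w \<in> T \<Longrightarrow> cmod (F w) \<le> cmod (F z1)"
    using continuous_attains_sup[of T "\<lambda>w. cmod (F w)"] by blast
  have "cmod (F w) \<le> cmod (F z1)" if "w \<in> S" for w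
    using that z1 by (cases "w \<in> T") (auto simp: T_def)
  then have "F constant_on S"
    using z1(1) by (intro maximum_modulus_principle[OF F S(1,2,1), of z1]) (auto simp: T_def)
  then have "F w = F z" if "w \<in> S" for w
    using that z unfolding constant_on_def by metis
  then have "T = S" using M by (auto simp: T_def)
  then have "closed S" using T compact_imp_closed by blast
  then have "S = UNIV" using clopen S(1) z by blast
  then show False using S(3) not_bounded_UNIV by blast
qed

text \<open>The bound for F and for 1 / F gives |F| = K throughout, so the maximum modulus is
  attained at interior points.\<close>

lemma constant_of_boundary_modulus:
  fixes F :: "complex \<Rightarrow> complex"
  assumes S: "open S" "connected S" "bounded S" and F: "F holomorphic_on S"
    and nz: "\<And>z. z \<in> S \<Longrightarrow> F z \<noteq> 0" and K: "K > 0"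
    and bd: "\<And>x w. (\<And>n::nat. x n \<in> S) \<Longrightarrow> x \<longlonglongrightarrow> w \<Longrightarrow> w \<notin> S \<Longrightarrow> (\<lambda>n. cmod (F (x n))) \<longlonglongrightarrow> K"
  shows "F constant_on S"
proof -
  have eq: "cmod (F z) = K" if z: "z \<in> S" for z
  proof (rule antisym)
    show "cmod (F z) \<le> K" by (rule norm_le_boundary_limit[OF S F bd z])
    have "cmod (inverse (F z)) \<le> inverse K"
    proof (rule norm_le_boundary_limit[OF S _ _ z])
      show "(\<lambda>z. inverse (F z)) holomorphic_on S" using F nz by (intro holomorphic_intros)
      fix x w assume "\<And>n::nat. x n \<in> S" "x \<longlonglongrightarrow> w" "w \<notin> S"
      from bd[OF this] show "(\<lambda>n. cmod (inverse (F (x n)))) \<longlonglongrightarrow> inverse K"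
        using K by (auto simp: norm_inverse intro!: tendsto_inverse)
    qed
    then show "K \<le> cmod (F z)" using K nz[OF z] by (simp add: norm_inverse)
  qed
  show ?thesis
  proof (cases "S = {}")
    case False
    then obtain z where "z \<in> S" by blast
    then show ?thesis using eq by (intro maximum_modulus_principle[OF F S(1,2,1), of z]) auto
  qed (simp add: constant_on_def)
qed

section \<open>Dividing out the zeros\<close>

text \<open>The order of a zero survives a change of coordinate. This is needed because
  \<open>sphere_mult\<close> is measured in the standard charts, while the argument takes place in
  \<open>sphere_coord q\<close>. Finiteness of the zero set excludes that \<open>k\<close> vanishes
  identically near \<open>b\<close>.\<close>

lemma zero_factor_in_coordinate:
  assumes k: "k holomorphic_on S" "open S" "b \<in> S" "finite {z\<in>S. k z = 0}"
    and \<phi>: "\<phi> analytic_on {a}" "\<phi> a = b" and \<psi>: "\<psi> analytic_on {a}" "\<psi> a \<noteq> 0"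
    and eq: "\<forall>\<^sub>F w in nhds a. \<phi> w - b = (w - a) * \<psi> w"
  obtains h where "h analytic_on {a}" "h a \<noteq> 0"
    "\<forall>\<^sub>F w in nhds a. k (\<phi> w) = (w - a) ^ (if k b = 0 then nat (zorder k b) else 0) * h w"
proof -
  obtain r where r: "r > 0" "ball b r \<subseteq> S" using k(2,3) open_contains_ball by blast
  have "infinite (ball b r)" using r(1) by (intro uncountable_infinite uncountable_ball)
  then have "\<not> ball b r \<subseteq> {z\<in>S. k z = 0}" using k(4) finite_subset by blast
  then have "\<exists>w\<in>ball b r. k w \<noteq> 0" using r(2) by blast
  moreover have "k holomorphic_on ball b r" using k(1) r(2) holomorphic_on_subset by blast
  ultimately have z: "(if k b = 0 then 0 < zorder k b else zorder k b = 0) \<and>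
      (\<exists>r'>0. cball b r' \<subseteq> ball b r \<and> zor_poly k b holomorphic_on cball b r' \<and>
        (\<forall>w\<in>cball b r'. k w = zor_poly k b w * (w - b) ^ nat (zorder k b) \<and> zor_poly k b w \<noteq> 0))"
    using r(1) by (intro zorder_exist_zero) auto
  define n where "n = (if k b = 0 then nat (zorder k b) else 0)"
  have n: "n = nat (zorder k b)" using z by (auto simp: n_def)
  define g where "g = zor_poly k b"
  obtain r' where r': "r' > 0" "g holomorphic_on cball b r'"
      "\<And>w. w \<in> cball b r' \<Longrightarrow> k w = g w * (w - b) ^ n \<and> g w \<noteq> 0"
    using z unfolding n g_def by blast
  have "g holomorphic_on ball b r'" using r'(2) by (rule holomorphic_on_subset) auto
  then have ga: "g analytic_on {b}"
    using r'(1) by (meson analytic_at centre_in_ball open_ball)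
  have "(g \<circ> \<phi>) analytic_on {a}"
    using \<phi> ga by (intro analytic_on_compose) auto
  then have "(\<lambda>w. g (\<phi> w) * \<psi> w ^ n) analytic_on {a}"
    using \<psi>(1) by (auto simp: comp_def intro!: analytic_intros)
  moreover have "g (\<phi> a) * \<psi> a ^ n \<noteq> 0" using r'(1) r'(3)[of b] \<phi>(2) \<psi>(2) by simp
  moreover have "\<forall>\<^sub>F w in nhds a. k (\<phi> w) = (w - a) ^ n * (g (\<phi> w) * \<psi> w ^ n)"
  proof -
    have "isCont \<phi> a" using \<phi>(1) by (simp add: analytic_at_imp_isCont)
    then have "(\<phi> \<longlongrightarrow> b) (nhds a)"
      using \<phi>(2) by (metis isCont_def tendsto_at_iff_tendsto_nhds)
    then have "\<forall>\<^sub>F w in nhds a. \<phi> w \<in> ball b r'"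
      using r'(1) by (intro topological_tendstoD) auto
    with eq show ?thesis
    proof eventually_elim
      case (elim w)
      have "k (\<phi> w) = g (\<phi> w) * (\<phi> w - b) ^ n" using r'(3)[of "\<phi> w"] elim(2) by simp
      then show ?case using elim(1) by (simp add: power_mult_distrib mult_ac)
    qed
  qed
  ultimately show ?thesis unfolding n_def by (rule that)
qed

lemma prod_linear_split:
  fixes \<omega> :: "'j \<Rightarrow> complex"
  assumes "finite J"
  shows "(\<Prod>j\<in>J. w - \<omega> j) = (w - a) ^ card {j\<in>J. \<omega> j = a} * (\<Prod>j\<in>{j\<in>J. \<omega> j \<noteq> a}. w - \<omega> j)"
proof -
  have "J = {j\<in>J. \<omega> j = a} \<union> {j\<in>J. \<omega> j \<noteq> a}" by auto
  then have "(\<Prod>j\<in>J. w - \<omega> j) = (\<Prod>j\<in>{j\<in>J. \<omega> j = a}. w - \<omega> j) * (\<Prod>j\<in>{j\<in>J. \<omega> j \<noteq> a}. w - \<omega> j)"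
    using assms by (subst prod.union_disjoint[symmetric]) auto
  then show ?thesis by simp
qed

text \<open>The quotient is analytic only after its singularities are removed;
  \<open>remove_sings\<close> does this globally, and near each point the result agrees with the
  explicit local quotient \<open>H\<close>.\<close>

lemma divide_out_zeros:
  fixes \<omega> :: "'j \<Rightarrow> complex" and g :: "complex \<Rightarrow> complex"
  assumes J: "finite J"
    and loc: "\<And>a. a \<in> S \<Longrightarrow> \<exists>h. h analytic_on {a} \<and> h a \<noteq> 0 \<and>
      (\<forall>\<^sub>F w in nhds a. g w = (w - a) ^ card {j\<in>J. \<omega> j = a} * h w)"
  obtains F where "F analytic_on S" "\<And>z. z \<in> S \<Longrightarrow> F z \<noteq> 0"
    "\<And>z. z \<in> S \<Longrightarrow> g z = F z * (\<Prod>j\<in>J. z - \<omega> j)"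
proof -
  define F where "F = remove_sings (\<lambda>w. g w / (\<Prod>j\<in>J. w - \<omega> j))"
  have main: "F analytic_on {a} \<and> F a \<noteq> 0 \<and> g a = F a * (\<Prod>j\<in>J. a - \<omega> j)" if a: "a \<in> S" for a
  proof -
    define n where "n = card {j\<in>J. \<omega> j = a}"
    obtain h where h: "h analytic_on {a}" "h a \<noteq> 0"
        and ev: "\<forall>\<^sub>F w in nhds a. g w = (w - a) ^ n * h w"
      using loc[OF a] unfolding n_def by blast
    define Pa where "Pa w = (\<Prod>j\<in>{j\<in>J. \<omega> j \<noteq> a}. w - \<omega> j)" for w
    have split: "(\<Prod>j\<in>J. w - \<omega> j) = (w - a) ^ n * Pa w" for w
      unfolding n_def Pa_def by (rule prod_linear_split[OF J])
    have Pa: "Pa a \<noteq> 0" using J by (auto simp: Pa_def)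
    have Paa: "Pa analytic_on {a}" unfolding Pa_def by (intro analytic_intros)
    define H where "H w = h w / Pa w" for w
    have Ha: "H analytic_on {a}" unfolding H_def using h(1) Paa Pa by (intro analytic_intros) auto
    have "isCont Pa a" using Paa by (rule analytic_at_imp_isCont)
    then have "(Pa \<longlongrightarrow> Pa a) (nhds a)" by (simp add: isCont_def tendsto_at_iff_tendsto_nhds)
    then have "\<forall>\<^sub>F w in nhds a. Pa w \<noteq> 0" using Pa by (rule tendsto_imp_eventually_ne)
    moreover have "\<forall>\<^sub>F w in nhds a. H analytic_on {w}" using Ha unfolding eventually_nhds by (meson analytic_at)
    ultimately have "\<forall>\<^sub>F w in nhds a. Pa w \<noteq> 0 \<and> H analytic_on {w} \<and> g w = (w - a) ^ n * h w"
      using ev by eventually_elim auto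
    then obtain U where U: "open U" "a \<in> U"
        "\<And>w. w \<in> U \<Longrightarrow> Pa w \<noteq> 0 \<and> H analytic_on {w} \<and> g w = (w - a) ^ n * h w"
      unfolding eventually_nhds by blast
    \<comment> \<open>Analyticity at \<open>a\<close> requires agreement on a whole neighbourhood.
      Near any \<open>w\<close> in it, a punctured neighbourhood avoids \<open>a\<close>, so there
      the power of w - a can be cancelled.\<close>
    have FH: "F w = H w" if w: "w \<in> U" for w
      unfolding F_def
    proof (rule remove_sings_eqI)
      have "\<forall>\<^sub>F v in at w. v \<in> U - {a}"
        using U(1) w eventually_at_in_open[of U w] by (cases "w = a")
          (auto simp: eventually_conj_iff eventually_at_in_open' eventually_neq_at_within)
      then have "\<forall>\<^sub>F v in at w. H v = g v / (\<Prod>j\<in>J. v - \<omega> j)"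
      proof eventually_elim
        case (elim v) then show ?case using U(3)[of v] by (auto simp: split H_def)
      qed
      moreover have "H \<midarrow>w\<rightarrow> H w"
        using U(3)[OF w] analytic_at_imp_isCont isContD by blast
      ultimately show "(\<lambda>v. g v / (\<Prod>j\<in>J. v - \<omega> j)) \<midarrow>w\<rightarrow> H w"
        by (rule Lim_transform_eventually[rotated])
    qed
    have "F analytic_on {a}"
      using Ha analytic_at_cong[of F H a a] FH U(1,2) eventually_nhds by blast
    moreover have "F a \<noteq> 0" using FH[OF U(2)] h(2) Pa by (simp add: H_def)
    moreover have "g a = F a * (\<Prod>j\<in>J. a - \<omega> j)"
      using U(3)[OF U(2)] FH[OF U(2)] by (simp add: split H_def)
    ultimately show ?thesis by blast
  qed
  show ?thesis by (rule that[of F]) (use main analytic_on_analytic_at in blast)+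
qed

text \<open>The two coordinate changes are z = q + 1 / w at a finite point and 1 / z = w / (1 + q w)
  at infinity; both are locally biholomorphic.\<close>

lemma sphere_mult_factor:
  assumes \<Omega>: "open \<Omega>" and f: "sphere_holomorphic_on f \<Omega>" "finite {x\<in>\<Omega>. f x = 0}"
    and a: "sphere_coord q a \<in> \<Omega>"
  obtains h where "h analytic_on {a}" "h a \<noteq> 0"
    "\<forall>\<^sub>F w in nhds a. f (sphere_coord q w) =
       (w - a) ^ (if f (sphere_coord q a) = 0 then sphere_mult f (sphere_coord q a) else 0) * h w"
proof (cases "a = 0")
  case False
  let ?b = "q + inverse a"
  have x: "sphere_coord q a = Fin ?b" using False by (simp add: sphere_coord_def)
  have hol: "(f \<circ> Fin) holomorphic_on Fin -` \<Omega>" using f(1) by (simp add: sphere_holomorphic_on_def)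
  have fin: "finite {z \<in> Fin -` \<Omega>. (f \<circ> Fin) z = 0}"
    using finite_vimageI[OF f(2), of Fin] by (simp add: vimage_def inj_on_def)
  have ev: "\<forall>\<^sub>F w in nhds a. w \<noteq> 0" using False t1_space_nhds by blast
  obtain h where h: "h analytic_on {a}" "h a \<noteq> 0"
    and e: "\<forall>\<^sub>F w in nhds a. (f \<circ> Fin) (q + inverse w) = (w - a) ^
        (if (f \<circ> Fin) ?b = 0 then nat (zorder (f \<circ> Fin) ?b) else 0) * h w"
  proof (rule zero_factor_in_coordinate[OF hol open_Fin_vimage[OF \<Omega>] _ fin, of ?b "\<lambda>w. q + inverse w" a "\<lambda>w. - inverse (w * a)"])
    show "\<forall>\<^sub>F w in nhds a. q + inverse w - ?b = (w - a) * (- inverse (w * a))"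
      using ev by eventually_elim (use False in \<open>simp add: field_simps\<close>)
  qed (use a x False in \<open>auto intro!: analytic_intros\<close>)
  have "\<forall>\<^sub>F w in nhds a. f (sphere_coord q w) =
       (w - a) ^ (if f (sphere_coord q a) = 0 then sphere_mult f (sphere_coord q a) else 0) * h w"
    using e ev
  proof eventually_elim
    case (elim w)
    then show ?case by (auto simp: x sphere_mult_def comp_def sphere_coord_def[of q w])
  qed
  with h show ?thesis by (rule that)
next
  case True
  have x: "sphere_coord q a = Infty" using True by (simp add: sphere_coord_def)
  have c0: "chart_inf 0 = Infty" by (simp add: chart_inf_def)
  have hol: "(f \<circ> chart_inf) holomorphic_on chart_inf -` \<Omega>" using f(1) by (simp add: sphere_holomorphic_on_def)
  have o: "open (chart_inf -` \<Omega>)"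
    unfolding chart_inf_eq_sphere_coord by (rule open_sphere_coord_vimage[OF \<Omega>])
  have "inj chart_inf" by (rule injI) (auto simp: chart_inf_def split: if_splits)
  then have fin: "finite {z \<in> chart_inf -` \<Omega>. (f \<circ> chart_inf) z = 0}"
    using finite_vimageI[OF f(2), of chart_inf] by (simp add: vimage_def)
  have "((\<lambda>w. 1 + q * w) \<longlongrightarrow> 1 + q * 0) (nhds 0)" by (intro tendsto_intros filterlim_ident)
  then have ev: "\<forall>\<^sub>F w in nhds 0. 1 + q * w \<noteq> 0" by (rule tendsto_imp_eventually_ne) simp
  obtain h where h: "h analytic_on {0}" "h 0 \<noteq> 0"
    and e: "\<forall>\<^sub>F w in nhds 0. (f \<circ> chart_inf) (w / (1 + q * w)) = (w - 0) ^
        (if (f \<circ> chart_inf) 0 = 0 then nat (zorder (f \<circ> chart_inf) 0) else 0) * h w"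
  proof (rule zero_factor_in_coordinate[OF hol o _ fin, of 0 "\<lambda>w. w / (1 + q * w)" 0 "\<lambda>w. 1 / (1 + q * w)"])
  qed (use a x c0 in \<open>auto intro!: analytic_intros\<close>)
  have "\<forall>\<^sub>F w in nhds 0. f (sphere_coord q w) =
       (w - a) ^ (if f (sphere_coord q a) = 0 then sphere_mult f (sphere_coord q a) else 0) * h w"
    using e ev
  proof eventually_elim
    case (elim w)
    have "chart_inf (w / (1 + q * w)) = sphere_coord q w"
      using elim(2) by (auto simp: chart_inf_def sphere_coord_def field_simps)
    then show ?case using elim(1) True
      by (auto simp: x[unfolded True] sphere_mult_def comp_def c0)
  qed
  with h show ?thesis using that True by blast
qed

text \<open>By the convention \<open>inverse 0 = 0\<close> the points \<open>Fin q\<close> and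
  \<open>Infty\<close> receive the same value, so this inverts \<open>sphere_coord q\<close> only
  off \<open>Fin q\<close>.\<close>

definition inv_coord :: "complex \<Rightarrow> rsphere \<Rightarrow> complex" where
  "inv_coord q x = (case x of Fin z \<Rightarrow> inverse (z - q) | Infty \<Rightarrow> 0)"

lemma inv_coord_sphere_coord [simp]: "inv_coord q (sphere_coord q w) = w"
  by (simp add: inv_coord_def sphere_coord_def)

lemma sphere_coord_inv_coord: "x \<noteq> Fin q \<Longrightarrow> sphere_coord q (inv_coord q x) = x"
  by (cases x) (auto simp: inv_coord_def sphere_coord_def)

lemma continuous_on_inv_coord: "continuous_on (- {Fin q}) (inv_coord q)"
proof -
  have "Fin -` (- {Fin q}) = - {q}" by auto
  then have o: "open (- {Fin q})" by (simp add: open_rsphere_def open_Compl)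
  show ?thesis
    unfolding continuous_on_open_vimage[OF o]
  proof (intro allI impI)
    fix A :: "complex set" assume A: "open A"
    have eq: "Fin -` (inv_coord q -` A \<inter> - {Fin q}) = - {q} \<inter> (\<lambda>z. inverse (z - q)) -` A"
      by (auto simp: inv_coord_def)
    have o': "open (- {q} \<inter> (\<lambda>z. inverse (z - q)) -` A)"
      using A by (intro continuous_open_preimage continuous_intros) auto
    have "bounded (- (- {q} \<inter> (\<lambda>z. inverse (z - q)) -` A))" if "0 \<in> A"
    proof -
      obtain e where e: "e > 0" "ball 0 e \<subseteq> A" using A \<open>0 \<in> A\<close> open_contains_ball by blast
      \<comment> \<open>Outside the disc of radius 1 / e around q the coordinate has modulus below
        e, so a neighbourhood of 0 pulls back to a neighbourhood of infinity.\<close>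
      have "- (- {q} \<inter> (\<lambda>z. inverse (z - q)) -` A) \<subseteq> cball q (inverse e)"
      proof
        fix z assume z: "z \<in> - (- {q} \<inter> (\<lambda>z. inverse (z - q)) -` A)"
        show "z \<in> cball q (inverse e)"
        proof (rule ccontr)
          assume "z \<notin> cball q (inverse e)"
          then have "inverse e < cmod (z - q)" by (simp add: dist_norm norm_minus_commute)
          moreover from this have "z \<noteq> q" using e(1) by auto
          ultimately have "cmod (inverse (z - q)) < e"
            using less_imp_inverse_less[of "inverse e" "cmod (z - q)"] e(1) by (simp add: norm_inverse)
          then have "inverse (z - q) \<in> A" using e(2) by auto
          then show False using z \<open>z \<noteq> q\<close> by auto
        qed
      qed
      then show ?thesis using bounded_cball bounded_subset by blast
    qed
    moreover have "Infty \<in> inv_coord q -` A \<inter> - {Fin q} \<longleftrightarrow> 0 \<in> A" by (simp add: inv_coord_def)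
    ultimately show "open (inv_coord q -` A \<inter> - {Fin q})"
      unfolding open_rsphere_def eq compact_eq_bounded_closed using o' closed_Compl by blast
  qed
qed

text \<open>Connectedness is inherited through the continuous inverse coordinate. A disc of radius e
  around q misses \<Omega>, which bounds the coordinate by 1 / e.\<close>

lemma sphere_coord_vimage_domain:
  assumes \<Omega>: "connected \<Omega>" and q: "Fin q \<notin> closure \<Omega>"
  shows "sphere_coord q -` \<Omega> = inv_coord q ` \<Omega>" "connected (sphere_coord q -` \<Omega>)" "bounded (sphere_coord q -` \<Omega>)"
proof -
  have qn: "Fin q \<notin> \<Omega>" using q closure_subset by blast
  show eq: "sphere_coord q -` \<Omega> = inv_coord q ` \<Omega>"
  proof (intro set_eqI iffI)
    fix w assume "w \<in> sphere_coord q -` \<Omega>"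
    then show "w \<in> inv_coord q ` \<Omega>" by (intro image_eqI[of _ _ "sphere_coord q w"]) auto
  next
    fix w assume "w \<in> inv_coord q ` \<Omega>"
    then obtain x where "x \<in> \<Omega>" "w = inv_coord q x" by blast
    moreover from this qn have "x \<noteq> Fin q" by auto
    ultimately show "w \<in> sphere_coord q -` \<Omega>" by (simp add: sphere_coord_inv_coord)
  qed
  have "continuous_on \<Omega> (inv_coord q)"
    by (rule continuous_on_subset[OF continuous_on_inv_coord]) (use qn in auto)
  then show "connected (sphere_coord q -` \<Omega>)"
    unfolding eq using \<Omega> by (rule connected_continuous_image)
  have "q \<notin> closure (Fin -` \<Omega>)" using q by (simp add: Fin_mem_closure_iff)
  then have "q \<in> - closure (Fin -` \<Omega>)" "open (- closure (Fin -` \<Omega>))" by auto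
  then obtain e where e: "e > 0" "ball q e \<subseteq> - closure (Fin -` \<Omega>)" using open_contains_ball by blast
  show "bounded (sphere_coord q -` \<Omega>)"
    unfolding bounded_iff
  proof (intro exI[of _ "inverse e"] ballI)
    fix w assume w: "w \<in> sphere_coord q -` \<Omega>"
    show "cmod w \<le> inverse e"
    proof (cases "w = 0")
      case False
      then have "q + inverse w \<in> Fin -` \<Omega>" using w by (simp add: sphere_coord_def)
      then have "q + inverse w \<notin> ball q e" using e(2) closure_subset by blast
      then have "e \<le> inverse (cmod w)" by (simp add: dist_norm norm_inverse)
      then show ?thesis using e(1) False le_imp_inverse_le[of e "inverse (cmod w)"] by simp
    qed (use e in simp)
  qed
qed

text \<open>For r < 1 the part of \<Omega> where |f| is at most r is compact, and so is its image in
  the coordinate. That image does not contain the limit point, so the sequence eventually leaves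
  it.\<close>

lemma proper_norm_tendsto_1:
  assumes f: "proper_on \<Omega> (ball 0 1) f" and \<Omega>: "connected \<Omega>" "Fin q \<notin> closure \<Omega>"
    and x: "\<And>n::nat. x n \<in> sphere_coord q -` \<Omega>" "x \<longlonglongrightarrow> w" "w \<notin> sphere_coord q -` \<Omega>"
  shows "(\<lambda>n. cmod (f (sphere_coord q (x n)))) \<longlonglongrightarrow> 1"
proof (rule order_tendstoI)
  have lt: "cmod (f (sphere_coord q (x n))) < 1" for n
    using f x(1)[of n] by (auto simp: proper_on_def)
  show "\<forall>\<^sub>F n in sequentially. cmod (f (sphere_coord q (x n))) < r" if "1 < r" for r
    using less_trans[OF lt that] by (rule always_eventually[OF allI])
  show "\<forall>\<^sub>F n in sequentially. r < cmod (f (sphere_coord q (x n)))" if "r < 1" for r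
  proof -
    let ?K = "{x \<in> \<Omega>. f x \<in> cball 0 r}"
    have "cball 0 r \<subseteq> ball (0 :: complex) 1 \<and> compact (cball (0 :: complex) r)" using that by auto
    then have "compact ?K" using f unfolding proper_on_def by blast
    moreover have "continuous_on ?K (inv_coord q)"
      by (rule continuous_on_subset[OF continuous_on_inv_coord]) (use \<Omega>(2) closure_subset in auto)
    ultimately have "closed (inv_coord q ` ?K)"
      using compact_continuous_image compact_imp_closed by blast
    moreover have "w \<notin> inv_coord q ` ?K" using x(3) sphere_coord_vimage_domain(1)[OF \<Omega>] by auto
    ultimately have "\<forall>\<^sub>F n in sequentially. x n \<in> - inv_coord q ` ?K"
      using x(2) by (intro topological_tendstoD) auto
    then show ?thesis
    proof eventually_elim
      case (elim n)
      then have "sphere_coord q (x n) \<notin> ?K" using image_eqI[of "x n" "inv_coord q" "sphere_coord q (x n)"] by force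
      then show ?case using x(1)[of n] by auto
    qed
  qed
qed

lemma sphere_coord_vimage_boundary:
  assumes \<Omega>: "open \<Omega>" "Infty \<in> \<Omega>"
    and x: "\<And>n::nat. x n \<in> sphere_coord q -` \<Omega>" "x \<longlonglongrightarrow> w" "w \<notin> sphere_coord q -` \<Omega>"
  shows "w \<noteq> 0" "q + inverse w \<in> frontier (Fin -` \<Omega>)"
proof -
  show w: "w \<noteq> 0" using x(3) \<Omega>(2) by (auto simp: sphere_coord_def)
  \<comment> \<open>Some terms may be 0, that is, the point at infinity; a tail of the sequence is
    finite in the variable z.\<close>
  have "\<forall>\<^sub>F n in sequentially. x n \<noteq> 0" using x(2) w by (rule tendsto_imp_eventually_ne)
  then obtain N where N: "\<And>n. n \<ge> N \<Longrightarrow> x n \<noteq> 0" unfolding eventually_sequentially by blast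
  have "(\<lambda>n. q + inverse (x (n + N))) \<longlonglongrightarrow> q + inverse w"
    using w LIMSEQ_ignore_initial_segment[OF x(2)] by (intro tendsto_intros)
  moreover have "q + inverse (x (n + N)) \<in> Fin -` \<Omega>" for n
    using x(1)[of "n + N"] N[of "n + N"] by (simp add: sphere_coord_def)
  ultimately have "q + inverse w \<in> closure (Fin -` \<Omega>)"
    unfolding closure_sequential by (intro exI[of _ "\<lambda>n. q + inverse (x (n + N))"] conjI allI)
  moreover have "q + inverse w \<notin> Fin -` \<Omega>" using x(3) w by (simp add: sphere_coord_def)
  ultimately show "q + inverse w \<in> frontier (Fin -` \<Omega>)"
    using open_Fin_vimage[OF \<Omega>(1)] by (simp add: frontier_def interior_open)
qed

section \<open>Products of linear polynomials\<close>

text \<open>A zero at infinity yields a factor with \<open>e j = 0\<close>, so the product can have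
  degree below \<open>card J\<close>; the statement therefore concerns the coefficient at
  \<open>card J\<close> and not the leading one.\<close>

lemma coeff_prod_linear:
  fixes b e :: "'j \<Rightarrow> complex"
  assumes "finite J"
  shows "degree (\<Prod>j\<in>J. [:b j, e j:]) \<le> card J \<and> coeff (\<Prod>j\<in>J. [:b j, e j:]) (card J) = (\<Prod>j\<in>J. e j)"
  using assms
proof induction
  case (insert k J)
  let ?p = "\<Prod>j\<in>J. [:b j, e j:]"
  have eq: "(\<Prod>j\<in>insert k J. [:b j, e j:]) = smult (b k) ?p + pCons 0 (smult (e k) ?p)"
    using insert by simp
  have "coeff ?p (Suc (card J)) = 0" using insert by (intro coeff_eq_0) simp
  moreover have "degree (smult (b k) ?p + pCons 0 (smult (e k) ?p)) \<le> Suc (card J)"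
    using insert.IH
    by (intro degree_add_le) (auto intro: order_trans[OF degree_smult_le] order_trans[OF degree_pCons_le])
  ultimately show ?case unfolding eq using insert by simp
qed simp

lemma coprime_complex_poly:
  fixes p r :: "complex poly"
  assumes "r \<noteq> 0" "\<And>z. poly r z = 0 \<Longrightarrow> poly p z \<noteq> 0"
  shows "coprime p r"
proof (rule coprimeI)
  fix c assume c: "c dvd p" "c dvd r"
  have "degree c = 0"
  proof (rule ccontr)
    assume "degree c \<noteq> 0"
    then have "\<exists>z. poly c z = 0"
      by (intro fundamental_theorem_of_algebra) (simp add: constant_degree)
    then obtain z where z: "poly c z = 0" ..
    from c obtain p' r' where "p = c * p'" "r = c * r'" by (elim dvdE)
    then have "poly p z = 0" "poly r z = 0" using z by simp_all
    then show False using assms(2) by blast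
  qed
  moreover have "c \<noteq> 0" using c assms(1) by auto
  ultimately show "is_unit c" by (simp add: is_unit_iff_degree)
qed

text \<open>With w = 1 / (z - q), one has 1 + w (q - a i) = w (z - a i) and w - \<omega> j = w (1 +
  q \<omega> j - z \<omega> j). The powers of w cancel because both products have the same number of
  factors.\<close>

lemma rational_of_coord:
  fixes a :: "'i \<Rightarrow> complex" and \<omega> :: "'j \<Rightarrow> complex"
  assumes fin: "finite I" "finite J" "card I = card J" and c: "c \<noteq> 0"
    and q: "Fin q \<notin> \<Omega>" and \<omega>: "\<And>j. j \<in> J \<Longrightarrow> sphere_coord q (\<omega> j) \<in> \<Omega>"
    and a: "\<And>i. i \<in> I \<Longrightarrow> Fin (a i) \<notin> \<Omega>"
    and f: "\<And>w. sphere_coord q w \<in> \<Omega> \<Longrightarrow>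
      f (sphere_coord q w) * (\<Prod>i\<in>I. 1 + w * (q - a i)) = c * (\<Prod>j\<in>J. w - \<omega> j)"
  shows "\<exists>R. rational_function R \<and> (\<forall>z\<in>\<Omega>. R z = Fin (f z))"
proof -
  define P where "P = smult c (\<Prod>j\<in>J. [:1 + q * \<omega> j, - \<omega> j:])"
  define Q where "Q = (\<Prod>i\<in>I. [:- a i, 1:])"
  have cQ: "degree Q \<le> card I" "coeff Q (card I) = 1"
    using coeff_prod_linear[OF fin(1), of "\<lambda>i. - a i" "\<lambda>_. 1"] by (auto simp: Q_def)
  then have dQ: "degree Q = card I" using le_degree[of Q "card I"] by simp
  have Q0: "Q \<noteq> 0" using cQ(2) by auto
  have dP: "degree P \<le> card I" "coeff P (card I) = c * (\<Prod>j\<in>J. - \<omega> j)"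
    using coeff_prod_linear[OF fin(2), of "\<lambda>j. 1 + q * \<omega> j" "\<lambda>j. - \<omega> j"] degree_smult_le[of c]
    by (auto simp: P_def fin(3) intro: order_trans)
  have pP: "poly P z = c * (\<Prod>j\<in>J. 1 + q * \<omega> j - z * \<omega> j)" for z
    by (simp add: P_def poly_prod)
  have pQ: "poly Q z = (\<Prod>i\<in>I. z - a i)" for z
    by (simp add: Q_def poly_prod)
  \<comment> \<open>The roots of \<open>P\<close> are the finite zeros in \<Omega>, while the roots
    of \<open>Q\<close> lie outside \<Omega>; this gives coprimality. For a zero at infinity the
    factor is the constant 1.\<close>
  have lin0: "1 + q * \<omega> j - z * \<omega> j = 0 \<longleftrightarrow> \<omega> j \<noteq> 0 \<and> sphere_coord q (\<omega> j) = Fin z" for j z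
    by (auto simp: sphere_coord_def field_simps)
  have "coprime P Q"
  proof (rule coprime_complex_poly[OF Q0])
    fix z assume "poly Q z = 0"
    then have z: "Fin z \<notin> \<Omega>" using a fin(1) by (auto simp: pQ)
    show "poly P z \<noteq> 0" using c fin(2) lin0[of _ z] \<omega> z by (force simp: pP)
  qed
  moreover have "rational_map P Q x = Fin (f x)" if x: "x \<in> \<Omega>" for x
  proof (cases x)
    case Infty
    \<comment> \<open>At w = 0 every factor of the left product is 1, and the right side is the
      coefficient of \<open>P\<close> at the degree of \<open>Q\<close>, as
      \<open>rational_map\<close> prescribes at infinity.\<close>
    have "f x * 1 = c * (\<Prod>j\<in>J. - \<omega> j)" using f[of 0] x Infty by (simp add: sphere_coord_def)
    then show ?thesis using Infty dP dQ cQ by (simp add: rational_map_def)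
  next
    case (Fin z)
    have zq: "z \<noteq> q" using x Fin q by auto
    define w where "w = inverse (z - q)"
    have w: "w \<noteq> 0" "q + inverse w = z" using zq by (simp_all add: w_def)
    have sc: "sphere_coord q w = x" using w Fin by (simp add: sphere_coord_def)
    have "1 + w * (q - a i) = w * (z - a i)" for i using zq by (simp add: w_def field_simps)
    then have 1: "(\<Prod>i\<in>I. 1 + w * (q - a i)) = w ^ card I * poly Q z"
      by (simp add: pQ prod.distrib)
    have "w - \<omega> j = w * (1 + q * \<omega> j - z * \<omega> j)" for j using zq by (simp add: w_def field_simps)
    then have 2: "c * (\<Prod>j\<in>J. w - \<omega> j) = w ^ card I * poly P z"
      by (simp add: pP prod.distrib fin(3))
    have "w ^ card I * (f x * poly Q z) = w ^ card I * poly P z"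
      using f[of w] sc x 1 2 by (simp add: mult_ac)
    then have "f x * poly Q z = poly P z" using w(1) by simp
    moreover have "poly Q z \<noteq> 0" using a fin(1) x Fin by (auto simp: pQ)
    ultimately show ?thesis using Fin by (simp add: rational_map_def field_simps)
  qed
  ultimately show ?thesis using Q0 unfolding rational_function_def by blast
qed

text \<open>
  With \<open>z = q + 1 / w\<close>, the identity on the boundary says that
  \<open>\<Prod> (z - \<zeta> j) / \<Prod> (z - a i)\<close> has constant modulus there.
\<close>

lemma rational_of_boundary_log_identity:
  fixes a :: "'i \<Rightarrow> complex" and \<zeta> :: "'j \<Rightarrow> rsphere"
  assumes fin: "finite I" "finite J" "card I = card J"
    and \<Omega>: "open \<Omega>" "connected \<Omega>" "Infty \<in> \<Omega>" and q: "Fin q \<notin> closure \<Omega>"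
    and f: "sphere_holomorphic_on f \<Omega>" "proper_on \<Omega> (ball 0 1) f" "finite {x\<in>\<Omega>. f x = 0}"
    and \<zeta>: "\<And>j. j \<in> J \<Longrightarrow> \<zeta> j \<in> \<Omega> \<and> f (\<zeta> j) = 0"
      "\<And>x. x \<in> \<Omega> \<Longrightarrow> f x = 0 \<Longrightarrow> card {j\<in>J. \<zeta> j = x} = sphere_mult f x"
    and a: "\<And>i. i \<in> I \<Longrightarrow> Fin (a i) \<notin> closure \<Omega>"
    and id: "\<And>z. z \<in> frontier (Fin -` \<Omega>) \<Longrightarrow>
      (\<Sum>i\<in>I. ln (cmod (z - a i))) = (\<Sum>j\<in>J. ln_dist z (\<zeta> j)) + C"
  shows "\<exists>R. rational_function R \<and> (\<forall>z\<in>\<Omega>. R z = Fin (f z))"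
proof -
  define S where "S = sphere_coord q -` \<Omega>"
  define \<omega> where "\<omega> j = inv_coord q (\<zeta> j)" for j
  define P where "P w = (\<Prod>j\<in>J. w - \<omega> j)" for w
  define Q where "Q w = (\<Prod>i\<in>I. 1 + w * (q - a i))" for w
  define K where "K = exp (C - (\<Sum>j\<in>J. ln (cmod (\<omega> j))))"
    \<comment> \<open>A zero at infinity has \<open>\<omega> j = 0\<close> and rightly contributes nothing, since \<open>ln 0 = 0\<close>.\<close>
  have qn: "Fin q \<notin> \<Omega>" and an: "\<And>i. i \<in> I \<Longrightarrow> Fin (a i) \<notin> \<Omega>" using q a closure_subset by blast+
  have S: "open S" "connected S" "bounded S"
    unfolding S_def
    by (rule open_sphere_coord_vimage[OF \<Omega>(1)] sphere_coord_vimage_domain[OF \<Omega>(2) q])+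
  have \<zeta>\<omega>: "sphere_coord q (\<omega> j) = \<zeta> j" if "j \<in> J" for j
    unfolding \<omega>_def using \<zeta>(1)[OF that] qn by (intro sphere_coord_inv_coord) auto
  then have \<omega>S: "\<omega> j \<in> S" if "j \<in> J" for j using that \<zeta>(1) by (simp add: S_def)
  have "\<exists>h. h analytic_on {b} \<and> h b \<noteq> 0 \<and>
      (\<forall>\<^sub>F w in nhds b. f (sphere_coord q w) = (w - b) ^ card {j\<in>J. \<omega> j = b} * h w)" if b: "b \<in> S" for b
  proof -
    have "{j\<in>J. \<omega> j = b} = {j\<in>J. \<zeta> j = sphere_coord q b}"
      using \<zeta>\<omega> by (auto simp: \<omega>_def)
    moreover have "{j\<in>J. \<zeta> j = sphere_coord q b} = {}" if "f (sphere_coord q b) \<noteq> 0"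
      using \<zeta>(1) that by force
    then have "card {j\<in>J. \<zeta> j = sphere_coord q b} = 0" if "f (sphere_coord q b) \<noteq> 0"
      using that by (metis card.empty)
    ultimately have n: "card {j\<in>J. \<omega> j = b} = (if f (sphere_coord q b) = 0 then sphere_mult f (sphere_coord q b) else 0)"
      using \<zeta>(2)[of "sphere_coord q b"] b by (simp add: S_def)
    have "sphere_coord q b \<in> \<Omega>" using b by (simp add: S_def)
    from sphere_mult_factor[OF \<Omega>(1) f(1,3) this] show ?thesis unfolding n by blast
  qed
  from divide_out_zeros[OF fin(2) this] obtain F where F: "F analytic_on S" "\<And>z. z \<in> S \<Longrightarrow> F z \<noteq> 0"
      "\<And>z. z \<in> S \<Longrightarrow> f (sphere_coord q z) = F z * P z"
    unfolding P_def by blast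
  have Q0: "Q w \<noteq> 0" if "w \<in> S" for w
  proof -
    have "1 + w * (q - a i) \<noteq> 0" if i: "i \<in> I" for i
    proof (cases "w = 0")
      case False
      then have "q + inverse w \<noteq> a i" using an[OF i] \<open>w \<in> S\<close> by (auto simp: S_def sphere_coord_def)
      then show ?thesis using False by (auto simp: field_simps)
    qed simp
    then show ?thesis using fin by (simp add: Q_def)
  qed
  \<comment> \<open>Away from the zeros this function is f Q / P. Since |f| tends to 1, its boundary
    modulus is |Q| / |P|, which the identity \<open>id\<close> shows to be \<open>K\<close>.\<close>
  have "(\<lambda>w. F w * Q w) constant_on S"
  proof (rule constant_of_boundary_modulus[OF S])
    show "(\<lambda>w. F w * Q w) holomorphic_on S"
      using analytic_imp_holomorphic[OF F(1)] unfolding Q_def by (intro holomorphic_intros)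
    show "F w * Q w \<noteq> 0" if "w \<in> S" for w using F(2) Q0 that by simp
    show "K > 0" by (simp add: K_def)
    fix x w assume x: "\<And>n::nat. x n \<in> S" "x \<longlonglongrightarrow> w" "w \<notin> S"
    note x' = x[unfolded S_def]
    have w: "w \<noteq> 0" "q + inverse w \<in> frontier (Fin -` \<Omega>)"
      using sphere_coord_vimage_boundary[OF \<Omega>(1,3) x'] by auto
    define z where "z = q + inverse w"
    have zc: "Fin z \<in> closure \<Omega>" "Fin z \<notin> \<Omega>"
      using w(2) open_Fin_vimage[OF \<Omega>(1)] by (auto simp: z_def Fin_mem_closure_iff frontier_def interior_open)
    have ne: "w \<noteq> \<omega> j" if "j \<in> J" for j using \<omega>S[OF that] x(3) by auto
    have nea: "z \<noteq> a i" if "i \<in> I" for i using a[OF that] zc(1) by auto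
    have qa: "1 + w * (q - a i) = w * (z - a i)" for i using w(1) by (simp add: z_def field_simps)
    have Pw: "P w \<noteq> 0" using ne fin(2) by (simp add: P_def)
    have Qw: "Q w \<noteq> 0" using nea w(1) fin(1) by (simp add: Q_def qa)
    have "ln (cmod (Q w)) = (\<Sum>i\<in>I. ln (cmod (1 + w * (q - a i))))"
      unfolding Q_def using nea w(1) fin by (auto simp: prod_norm[symmetric] qa intro!: ln_prod)
    also have "\<dots> = (\<Sum>i\<in>I. ln (cmod w) + ln (cmod (z - a i)))"
      using nea w(1) by (intro sum.cong) (auto simp: qa norm_mult ln_mult)
    \<comment> \<open>Because \<open>card I = card J\<close>, one term ln |w| per \<open>a i\<close>
      can be redistributed as one per zero, where it turns the distance from z to
      \<open>\<zeta> j\<close> into the distance from w to \<open>\<omega> j\<close>.\<close>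
    also have "\<dots> = of_nat (card J) * ln (cmod w) + (\<Sum>j\<in>J. ln_dist z (\<zeta> j)) + C"
      using id[OF w(2)] by (simp add: sum.distrib z_def fin(3))
    also have "\<dots> = (\<Sum>j\<in>J. ln (cmod w) + ln_dist z (\<zeta> j)) + C"
      by (simp add: sum.distrib)
    also have "(\<Sum>j\<in>J. ln (cmod w) + ln_dist z (\<zeta> j)) = (\<Sum>j\<in>J. ln (cmod (w - \<omega> j)) - ln (cmod (\<omega> j)))"
    proof (rule sum.cong[OF refl])
      fix j assume j: "j \<in> J"
      show "ln (cmod w) + ln_dist z (\<zeta> j) = ln (cmod (w - \<omega> j)) - ln (cmod (\<omega> j))"
      proof (cases "\<omega> j = 0")
        case True
        then have "\<zeta> j = Infty" using \<zeta>\<omega>[OF j] by (simp add: sphere_coord_def)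
        then show ?thesis using True by (simp add: ln_dist_def)
      next
        case False
        then have e: "\<zeta> j = Fin (q + inverse (\<omega> j))" using \<zeta>\<omega>[OF j] by (simp add: sphere_coord_def)
        have "z - (q + inverse (\<omega> j)) = (\<omega> j - w) / (w * \<omega> j)"
          using False w(1) by (simp add: z_def field_simps)
        then have "cmod (z - (q + inverse (\<omega> j))) = cmod (w - \<omega> j) / (cmod w * cmod (\<omega> j))"
          by (simp add: norm_divide norm_mult norm_minus_commute)
        then show ?thesis using False w(1) ne[OF j] by (simp add: e ln_dist_def ln_div ln_mult)
      qed
    qed
    also have "(\<Sum>j\<in>J. ln (cmod (w - \<omega> j)) - ln (cmod (\<omega> j))) + C = ln (cmod (P w)) + ln K"
    proof -
      have "ln (cmod (P w)) = (\<Sum>j\<in>J. ln (cmod (w - \<omega> j)))"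
        unfolding P_def using ne fin by (auto simp: prod_norm[symmetric] intro!: ln_prod)
      then show ?thesis by (simp add: sum_subtractf K_def)
    qed
    finally have "ln (cmod (Q w)) = ln (cmod (P w) * K)"
      using Pw by (simp add: ln_mult K_def)
    then have QP: "cmod (Q w) = cmod (P w) * K" using Pw Qw by (simp add: K_def)
    have cP: "isCont P w" "isCont Q w" unfolding P_def Q_def by (intro continuous_intros)+
    have lP: "(\<lambda>n. P (x n)) \<longlonglongrightarrow> P w" "(\<lambda>n. Q (x n)) \<longlonglongrightarrow> Q w"
      using isCont_tendsto_compose[OF cP(1) x(2)] isCont_tendsto_compose[OF cP(2) x(2)] .
    have "(\<lambda>n. cmod (f (sphere_coord q (x n))) * cmod (Q (x n)) / cmod (P (x n))) \<longlonglongrightarrow> 1 * cmod (Q w) / cmod (P w)"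
      using Pw by (intro tendsto_intros lP proper_norm_tendsto_1[OF f(2) \<Omega>(2) q x']) auto
    moreover have "\<forall>\<^sub>F n in sequentially. P (x n) \<noteq> 0" using lP(1) Pw by (rule tendsto_imp_eventually_ne)
    then have "\<forall>\<^sub>F n in sequentially. cmod (f (sphere_coord q (x n))) * cmod (Q (x n)) / cmod (P (x n)) = cmod (F (x n) * Q (x n))"
      by eventually_elim (simp add: F(3)[OF x(1)] norm_mult)
    ultimately have "(\<lambda>n. cmod (F (x n) * Q (x n))) \<longlonglongrightarrow> 1 * cmod (Q w) / cmod (P w)"
      by (rule Lim_transform_eventually)
    then show "(\<lambda>n. cmod (F (x n) * Q (x n))) \<longlonglongrightarrow> K" using QP Pw by simp
  qed
  then obtain c where c: "\<And>w. w \<in> S \<Longrightarrow> F w * Q w = c" unfolding constant_on_def by blast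
  have "0 \<in> S" using \<Omega>(3) by (simp add: S_def sphere_coord_def)
  then have "c \<noteq> 0" using c[of 0] F(2)[of 0] Q0[of 0] by auto
  show ?thesis
  proof (rule rational_of_coord[OF fin \<open>c \<noteq> 0\<close> qn _ an])
    show "sphere_coord q (\<omega> j) \<in> \<Omega>" if "j \<in> J" for j using \<omega>S[OF that] by (simp add: S_def)
    fix w assume "sphere_coord q w \<in> \<Omega>"
    then have "w \<in> S" by (simp add: S_def)
    then show "f (sphere_coord q w) * (\<Prod>i\<in>I. 1 + w * (q - a i)) = c * (\<Prod>j\<in>J. w - \<omega> j)"
      using F(3)[of w] c[of w] unfolding P_def Q_def by (metis mult.commute mult.assoc)
  qed
qed

section \<open>Existence of a boundary point, and the assembly of the theorem\<close>

lemma frontier_vimage_nonempty: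
  assumes "open \<Omega>" "Infty \<in> \<Omega>" "proper_holomorphic_of_degree f \<Omega> d"
  shows "frontier (Fin -` \<Omega>) \<noteq> {}"
proof
  assume "frontier (Fin -` \<Omega>) = {}"
  then have "Fin -` \<Omega> = UNIV \<or> Fin -` \<Omega> = {}" by (auto simp: frontier_eq_empty)
  moreover have "Fin -` \<Omega> \<noteq> {}"
    using bounded_Compl_Fin_vimage[OF assms(1,2)] not_bounded_UNIV by force
  ultimately have U: "Fin -` \<Omega> = UNIV" by blast
  note deg = assms(3)[unfolded proper_holomorphic_of_degree_def sphere_holomorphic_on_def proper_on_def]
  \<comment> \<open>Without finite frontier points f would be a bounded entire function, constant by
    Liouville's theorem, against the finiteness of its fibres.\<close>
  have f: "(f \<circ> Fin) holomorphic_on UNIV" using deg U by metis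
  have Fin: "Fin z \<in> \<Omega>" for z using U by blast
  have b: "f (Fin z) \<in> ball 0 1" for z using deg Fin[of z] by blast
  then have "bounded (range (f \<circ> Fin))"
    by (intro bounded_subset[OF bounded_ball[of 0 1]]) auto
  then obtain c where c: "\<And>z. (f \<circ> Fin) z = c" using Liouville_theorem[OF f] unfolding constant_on_def by blast
  then have "range Fin \<subseteq> {z\<in>\<Omega>. f z = c}" using Fin by auto
  moreover have "finite {z\<in>\<Omega>. f z = c}"
  proof -
    have "c \<in> ball 0 1" using b[of 0] c[of 0] by simp
    then show ?thesis using deg by blast
  qed
  moreover have "infinite (range Fin)"
    using infinite_UNIV_char_0[where 'a = complex] by (simp add: finite_image_iff inj_on_def)
  ultimately show False using finite_subset by blast
qed

theorem theorem3p2: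
  fixes \<Omega> :: "rsphere set" and d :: nat and \<gamma> :: "nat \<Rightarrow> complex set"
    and f :: "rsphere \<Rightarrow> complex" and \<zeta> p :: "nat \<Rightarrow> rsphere"
    and \<mu> \<nu> :: "nat \<Rightarrow> rsphere measure"
  assumes "open \<Omega>" and "connected \<Omega>" and "Infty \<in> \<Omega>"
    and "finite (components (- \<Omega>))"
    and "\<And>i. i \<in> {1..d} \<Longrightarrow> analytic_Jordan_curve (\<gamma> i)"
    and "disjoint_family_on \<gamma> {1..d}"
    and "frontier \<Omega> = (\<Union>i\<in>{1..d}. Fin ` \<gamma> i)"
    and "proper_holomorphic_of_degree f \<Omega> d"
    and "\<And>j. j \<in> {1..d} \<Longrightarrow> \<zeta> j \<in> \<Omega> \<and> f (\<zeta> j) = 0"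
    and "\<And>z. z \<in> \<Omega> \<Longrightarrow> f z = 0 \<Longrightarrow> card {j \<in> {1..d}. \<zeta> j = z} = sphere_mult f z"
    and "\<And>i. i \<in> {1..d} \<Longrightarrow> p i \<in> bounded_component (Fin ` \<gamma> i)"
    and "\<And>i. i \<in> {1..d} \<Longrightarrow> is_harmonic_measure (- closure \<Omega>) (p i) (\<mu> i)"
    and "\<And>j. j \<in> {1..d} \<Longrightarrow> is_harmonic_measure \<Omega> (\<zeta> j) (\<nu> j)"
    and "\<And>E. E \<in> sets borel \<Longrightarrow> E \<subseteq> frontier \<Omega> \<Longrightarrow>
           (\<Sum>i=1..d. measure (\<mu> i) E) = (\<Sum>j=1..d. measure (\<nu> j) E)"
  shows "\<exists>R. rational_function R \<and> (\<forall>z\<in>\<Omega>. R z = Fin (f z))"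
proof -
  note \<Omega> = assms(1-3) and \<gamma> = assms(5-7) and \<zeta> = assms(9,10)
  define I where "I = {1..d}"
  define B where "B = (\<Union>i\<in>I. \<gamma> i)"
  define W where "W = Fin -` \<Omega>"
  have \<gamma>J: "analytic_Jordan_curve (\<gamma> i)" if "i \<in> I" for i using \<gamma>(1) that by (simp add: I_def)
  have FB: "frontier \<Omega> = Fin ` B" using \<gamma>(3) by (auto simp: B_def I_def)
  have W: "open W" "frontier W = B"
    using frontier_open_iff[OF \<Omega>(1)] FB open_Fin_vimage[OF \<Omega>(1)] by (auto simp: W_def)
  have sub: "Fin ` \<gamma> i \<subseteq> frontier \<Omega>" if "i \<in> I" for i using that by (auto simp: FB B_def)
  have B: "B \<in> sets borel"
    using W(2) by (intro borel_closed) (metis frontier_closed)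
  have ins: "closure \<Omega> \<inter> Fin ` inside (\<gamma> i) = {}" if "i \<in> I" for i
    by (rule domain_disjoint_inside[OF \<Omega> \<gamma>J[OF that] sub[OF that]])
  have "\<exists>a. \<forall>i\<in>I. p i = Fin (a i) \<and> a i \<in> inside (\<gamma> i)"
  proof (intro bchoice ballI)
    fix i assume i: "i \<in> I"
    then have "p i \<in> Fin ` inside (\<gamma> i)"
      using bounded_component_inside[OF \<gamma>J] assms(11) by (simp add: I_def)
    then show "\<exists>a. p i = Fin a \<and> a \<in> inside (\<gamma> i)" by blast
  qed
  then obtain a where a: "\<And>i. i \<in> I \<Longrightarrow> p i = Fin (a i)" "\<And>i. i \<in> I \<Longrightarrow> a i \<in> inside (\<gamma> i)" by blast
  have ao: "Fin (a i) \<notin> closure \<Omega>" if "i \<in> I" for i using ins[OF that] a(2)[OF that] by blast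
  define m where "m i = distr (\<mu> i) borel fin_part" for i
  define n where "n j = distr (\<nu> j) borel fin_part" for j
  have hm: "is_harmonic_measure (- closure \<Omega>) (Fin (a i)) (\<mu> i)" if "i \<in> I" for i
    using assms(12)[of i] a(1)[OF that] that by (simp add: I_def)
  have hn: "is_harmonic_measure \<Omega> (\<zeta> j) (\<nu> j)" if "j \<in> I" for j
    using assms(13) that by (simp add: I_def)
  have z: "\<zeta> j \<in> \<Omega>" if "j \<in> I" for j using \<zeta>(1) that by (simp add: I_def)
  have \<mu>: "prob_space (\<mu> i)" "sets (\<mu> i) = sets borel" "emeasure (\<mu> i) (Fin ` \<gamma> i) = 1" if i: "i \<in> I" for i
    using hm[OF i] component_inside[OF \<Omega> \<gamma>J[OF i] sub[OF i], of "Fin (a i)"] a(2)[OF i]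
      frontier_Fin_inside[OF \<gamma>J[OF i]]
    unfolding is_harmonic_measure_def Let_def by auto
  \<comment> \<open>Each \<open>\<mu> i\<close> lives on its own curve; it is regarded as a measure
    on the whole boundary in order to be compared with the \<open>\<nu> j\<close>.\<close>
  have \<mu>B: "emeasure (\<mu> i) (Fin ` B) = 1" if i: "i \<in> I" for i
  proof (rule antisym)
    interpret prob_space "\<mu> i" by (rule \<mu>(1)[OF i])
    show "emeasure (\<mu> i) (Fin ` B) \<le> 1" by (rule emeasure_le_1)
    have "emeasure (\<mu> i) (Fin ` \<gamma> i) \<le> emeasure (\<mu> i) (Fin ` B)"
      using i Fin_image_borel[OF B] \<mu>(2)[OF i] by (intro emeasure_mono) (auto simp: B_def)
    then show "1 \<le> emeasure (\<mu> i) (Fin ` B)" using \<mu>(3)[OF i] by simp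
  qed
  have comp: "connected_component_set \<Omega> (\<zeta> j) = \<Omega>" if "j \<in> I" for j
    using connected_component_maximal[OF z[OF that] \<Omega>(2) order_refl] connected_component_subset[of \<Omega> "\<zeta> j"] by blast
  have \<nu>: "prob_space (\<nu> j)" "sets (\<nu> j) = sets borel" "emeasure (\<nu> j) (Fin ` B) = 1" if "j \<in> I" for j
    using hn[OF that] comp[OF that] FB unfolding is_harmonic_measure_def Let_def by auto
  note md = fin_part_distr[OF \<mu>(1,2) \<mu>B B, folded m_def]
  note nd = fin_part_distr[OF \<nu> B, folded n_def]
  \<comment> \<open>The hypothesis concerns subsets of the frontier only. An arbitrary Borel set is
    first cut down to \<open>B\<close>, which carries all the measures.\<close>
  have mn: "(\<Sum>i\<in>I. emeasure (m i) E) = (\<Sum>j\<in>I. emeasure (n j) E)" if E: "E \<in> sets borel" for E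
  proof -
    have EB: "E \<inter> B \<in> sets borel" using E B by auto
    have em: "emeasure M E = ennreal (measure M (E \<inter> B))"
      if "prob_space M" "sets M = sets borel" "AE z in M. z \<in> B" for M :: "complex measure"
    proof -
      interpret prob_space M by fact
      have "emeasure M E = emeasure M (E \<inter> B)"
      proof (rule emeasure_eq_AE)
        show "AE x in M. x \<in> E \<longleftrightarrow> x \<in> E \<inter> B" using that(3) by eventually_elim auto
      qed (use that(2) E EB in simp_all)
      then show ?thesis by (simp add: emeasure_eq_measure)
    qed
    have "(\<Sum>i\<in>I. measure (\<mu> i) (Fin ` (E \<inter> B))) = (\<Sum>j\<in>I. measure (\<nu> j) (Fin ` (E \<inter> B)))"
      unfolding I_def by (rule assms(14)[OF Fin_image_borel[OF EB]]) (auto simp: FB)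
    then have "(\<Sum>i\<in>I. measure (m i) (E \<inter> B)) = (\<Sum>j\<in>I. measure (n j) (E \<inter> B))"
      using md(3)[OF _ _ _ EB] nd(3)[OF _ _ _ EB] by simp
    moreover have "emeasure (m i) E = ennreal (measure (m i) (E \<inter> B))" if "i \<in> I" for i
      using that by (intro em md(1,2)) (simp_all add: m_def)
    then have "(\<Sum>i\<in>I. emeasure (m i) E) = ennreal (\<Sum>i\<in>I. measure (m i) (E \<inter> B))"
      by (simp flip: sum_ennreal)
    moreover have "emeasure (n j) E = ennreal (measure (n j) (E \<inter> B))" if "j \<in> I" for j
      using that by (intro em nd(1,2)) (simp_all add: n_def)
    then have "(\<Sum>j\<in>I. emeasure (n j) E) = ennreal (\<Sum>j\<in>I. measure (n j) (E \<inter> B))"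
      by (simp flip: sum_ennreal)
    ultimately show ?thesis by simp
  qed
  obtain C where C: "\<And>w. w \<in> B \<Longrightarrow> (\<Sum>i\<in>I. ln (cmod (w - a i))) = (\<Sum>j\<in>I. ln_dist w (\<zeta> j)) + C"
  proof (rule boundary_log_identity[of I I \<gamma> B W a m n "\<lambda>j w. ln_dist w (\<zeta> j)"])
    show "finite I" "finite I" by (simp_all add: I_def)
    show "analytic_Jordan_curve (\<gamma> i)" if "i \<in> I" for i by (rule \<gamma>J[OF that])
    show "disjoint_family_on \<gamma> I" using \<gamma>(2) by (simp add: I_def)
    show "B = (\<Union>i\<in>I. \<gamma> i)" by (rule B_def)
    show "open W" "frontier W = B" by (rule W)+
    show "inside (\<gamma> i) \<inter> B = {}" if "i \<in> I" for i
      using ins[OF that] FB by (auto simp: frontier_def)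
    show "a i \<in> inside (\<gamma> i)" if "i \<in> I" for i by (rule a(2)[OF that])
    show "prob_space (m i)" "AE z in m i. z \<in> B" "sets (m i) = sets borel" if "i \<in> I" for i
      using md(1,2)[OF that that that] by (simp_all add: m_def)
    show "prob_space (n i)" "AE z in n i. z \<in> B" "sets (n i) = sets borel" if "i \<in> I" for i
      using nd(1,2)[OF that that that] by (simp_all add: n_def)
    show "(\<Sum>i\<in>I. emeasure (m i) E) = (\<Sum>j\<in>I. emeasure (n j) E)" if "E \<in> sets borel" for E
      by (rule mn[OF that])
    show "(\<integral>z. ln (cmod (w - z)) \<partial>m i) = ln (cmod (w - a i))" if i: "i \<in> I" and w: "w \<in> W" for i w
    proof -
      have "\<gamma> i \<in> sets borel"
        using analytic_Jordan_curve_inside(1)[OF \<gamma>J[OF i]] by (intro borel_compact)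
      \<comment> \<open>Here the transport is taken over the single curve, since the representation
        formula for \<open>\<mu> i\<close> integrates over the boundary of the inside of
        \<open>\<gamma> i\<close>; the transported measure is the same \<open>m i\<close>.\<close>
      then have "(LINT x:Fin ` \<gamma> i|\<mu> i. ln (cmod (w - fin_part x))) = (\<integral>z. ln (cmod (w - z)) \<partial>m i)"
        unfolding m_def by (rule fin_part_distr(4)[OF \<mu>[OF i]]) auto
      moreover have "w \<notin> inside (\<gamma> i)" using ins[OF i] w closure_subset[of \<Omega>] by (auto simp: W_def)
      moreover have "w \<notin> \<gamma> i"
        using sub[OF i] w \<Omega>(1) by (auto simp: W_def frontier_def interior_open)
      ultimately show ?thesis
        using harmonic_measure_ln_norm_inside[OF \<Omega> \<gamma>J[OF i] sub[OF i] a(2)[OF i] hm[OF i]] by simp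
    qed
    show "(\<integral>z. ln (cmod (w - z)) - ln (cmod (w' - z)) \<partial>n j) = ln_dist w (\<zeta> j) - ln_dist w' (\<zeta> j)"
      if j: "j \<in> I" and w: "w \<in> (\<Union>i\<in>I. inside (\<gamma> i))" "w' \<in> (\<Union>i\<in>I. inside (\<gamma> i))" for j w w'
    proof -
      have "(LINT x:Fin ` B|\<nu> j. ln_dist w x - ln_dist w' x) = (\<integral>z. ln (cmod (w - z)) - ln (cmod (w' - z)) \<partial>n j)"
        by (rule nd(4)[OF j j j]) (auto simp: ln_dist_def)
      moreover have "Fin w \<notin> closure \<Omega>" "Fin w' \<notin> closure \<Omega>" using w ins by blast+
      ultimately show ?thesis
        using harmonic_measure_ln_dist_outside[OF \<Omega>(1,2) z[OF j] \<Omega>(3) hn[OF j]] FB by simp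
    qed
    show "isCont (\<lambda>w. ln_dist w (\<zeta> j)) w" if j: "j \<in> I" and w: "w \<in> B" for j w
    proof (cases "\<zeta> j")
      case (Fin y)
      have "Fin w \<notin> \<Omega>" using w FB \<Omega>(1) by (auto simp: frontier_def interior_open)
      then have "w \<noteq> y" using z[OF j] Fin by auto
      then show ?thesis using Fin by (auto simp: ln_dist_def intro!: continuous_intros)
    qed (simp add: ln_dist_def)
  qed (rule that)
  \<comment> \<open>This provides at least one curve, and \<open>a i\<close> inside it serves as the
    centre q of the coordinate.\<close>
  have "frontier W \<noteq> {}" unfolding W_def by (rule frontier_vimage_nonempty[OF \<Omega>(1,3) assms(8)])
  then obtain i where i: "i \<in> I" using W(2) by (auto simp: B_def)
  have f: "sphere_holomorphic_on f \<Omega>" "proper_on \<Omega> (ball 0 1) f" "finite {x\<in>\<Omega>. f x = 0}"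
    using assms(8) by (auto simp: proper_holomorphic_of_degree_def)
  show ?thesis
  proof (rule rational_of_boundary_log_identity[OF _ _ refl \<Omega> ao[OF i] f])
    show "finite I" "finite I" by (simp_all add: I_def)
    show "\<zeta> j \<in> \<Omega> \<and> f (\<zeta> j) = 0" if "j \<in> I" for j using \<zeta>(1) that by (simp add: I_def)
    show "card {j\<in>I. \<zeta> j = x} = sphere_mult f x" if "x \<in> \<Omega>" "f x = 0" for x
      using \<zeta>(2) that by (simp add: I_def)
    show "Fin (a i) \<notin> closure \<Omega>" if "i \<in> I" for i by (rule ao[OF that])
    show "(\<Sum>i\<in>I. ln (cmod (x - a i))) = (\<Sum>j\<in>I. ln_dist x (\<zeta> j)) + C"
      if "x \<in> frontier (Fin -` \<Omega>)" for x
      using C that W(2) by (simp add: W_def)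
  qed
qed

end
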